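(* Let $n\ge3$ and $\tau>0$. (1) Let $q_\eta$, $\eta\in\mathbb R^{|\mathcal E|}$, be a Held--Karp-equilibrated rooted $1$-tree Gibbs law, i.e. $\mathbb E_{q_\eta}[d_i(U)]=2$ for all $i\in\bar V$, and let $u=\mu(\eta)$. Then $\mathcal C_{\rm Ber}(u)$ is a valid non-tour certificate: $\gamma(q_\eta)\le\mathcal C_{\rm Ber}(u)$. (2) Moreover, for any Held--Karp-equilibrated edge input $c\in\mathbb R^{|\mathcal E|}$, let $\eta(c)=c+A\lambda^\star(c)$ and $u(c)=\mu(\eta(c))$. For $c_\alpha=c+\alpha\,b_{\rm Ber}(u(c))$ and $u_\alpha=\mu\bigl(c_\alpha+A\lambda^\star(c_\alpha)\bigr)$, we have, for all sufficiently small $\alpha>0$, $$\mathcal C_{\rm Ber}(u_\alpha)<\mathcal C_{\rm Ber}(u(c)),$$ whenever the re-equilibrated sharpening direction is nonzero, i.e. whenever $\|T_c\,P_\perp b_{\rm Ber}(u(c))\|_{\Sigma_x}>0$.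
   Context: Let $V=\{1,\dots,n\}$, $n\ge3$, and let $\mathcal E$ be the edge set of the complete undirected graph on $V$. Fix a root $r\in V$ and set $\bar V:=V\setminus\{r\}$. A rooted $1$-tree is an edge set $U\subseteq\mathcal E$ consisting of the edges of a spanning tree of the complete graph on $\bar V$ together with exactly two distinct edges incident to $r$. $\mathcal U_r$ is the set of all rooted $1$-trees; $\mathcal H\subseteq\mathcal U_r$ is the set of (edge sets of) Hamiltonian cycles; for a distribution $q$ on $\mathcal U_r$, $\gamma(q):=q(\mathcal U_r\setminus\mathcal H)$. For $U\in\mathcal U_r$, $x_U\in\{0,1\}^{|\mathcal E|}$ is its edge-incidence vector and $d_i(U)$ the degree of node $i$. With temperature $\tau>0$ and $\eta\in\mathbb R^{|\mathcal E|}$, the Gibbs law is $q_\eta(U)=\frac{1}{Z_r(\eta)}\exp(-\frac1\tau\langle\eta,x_U\rangle)$, $U\in\mathcal U_r$, with $Z_r(\eta)=\sum_{U\in\mathcal U_r}\exp(-\frac1\tau\langle\eta,x_U\rangle)$, and $\mu(\eta):=\mathbb E_{q_\eta}[x_U]$. Vectors $\lambda\in\mathbb R^{n-1}$ are indexed by $\bar V$; $A:\mathbb R^{n-1}\to\mathbb R^{|\mathcal E|}$ is the linear map $(A\lambda)_{ij}=\lambda_i+\lambda_j$ for $i,j\in\bar V$ and $(A\lambda)_{rk}=\lambda_k$ for $k\in\bar V$. $B=A^\top$ is the non-root degree operator: $B_{ie}=1$ if $i\in\bar V$ is an endpoint of $e$ and $0$ otherwise, so $Bx_U=(d_i(U))_{i\in\bar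 V}$. The dual objective is $\Phi_\tau(c,\lambda):=-\tau\log Z_r(c+A\lambda)-2\,\mathbf 1^\top\lambda$, concave in $\lambda$; $\lambda^\star(c)$ denotes a maximizer, i.e. a solution of $\nabla_\lambda\Phi_\tau(c,\lambda^\star(c))=0$, equivalently $\mathbb E_{q_{c+A\lambda^\star(c)}}[d_i(U)]=2$ for all $i\in\bar V$. (Maximizers are determined up to directions leaving the Gibbs law $q_{c+A\lambda}$ unchanged; $\lambda^\star(\cdot)$ is a local selection, e.g. obtained by restricting $\lambda$ to a fixed nondegenerate subspace, that is differentiable at the input $c$ considered.) The Bernoulli certificate is $\mathcal C_{\rm Ber}(u):=\sum_{e\in\mathcal E}w_eu_e(1-u_e)$ with $w_e:=\frac12\sum_{i\in\bar V}B_{ie}$, and $b_{\rm Ber}(u):=\nabla_u\mathcal C_{\rm Ber}(u)=w\odot(1-2u)$ (entrywise product). $P_\perp$ is the Euclidean orthogonal projection onto $\operatorname{Im}(A)^\perp$. $T_c:=D\eta(c)$ is the derivative at $c$ of the map $c\mapsto\eta(c)=c+A\lambda^\star(c)$, $\Sigma_x:=\operatorname{Cov}_{q_{\eta(c)}}(x_U,x_U)$ is the edge-indicator covariance matrix, and $\|v\|_{\Sigma_x}^2:=v^\top\Sigma_xv$. *)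

theory Defs
  imports "HOL-Analysis.Analysis"
begin

text \<open>
  The vertex set is a finite type \<open>'v\<close> with \<open>n = CARD('v)\<close>. Edges of the complete graph are
  the two-element vertex sets; the sort \<open>card2\<close> (at least two elements) makes this set nonempty,
  so that it can be turned into a finite type and \<open>real ^ 'v edge\<close> serves as the edge space.
\<close>

typedef (overloaded) ('v::card2) edge = "{e :: 'v set. card e = 2}"
  morphisms ends Abs_edge
proof -
  obtain e :: "'v set" where "card e = 2"
    using obtain_subset_with_card_n[OF two_le_card[where 'a='v]] by auto
  then show ?thesis by blast
qed

instance edge :: (card2) finite
proof
  have "inj (ends :: 'a edge \<Rightarrow> 'a set)"
    by (auto simp: inj_on_def ends_inject)
  then show "finite (UNIV :: 'a edge set)"
    by (rule finite_imageD[rotated]) simp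
qed

section \<open>Rooted 1-trees and Hamiltonian cycles\<close>

definition cycle_edges :: "'v::card2 list \<Rightarrow> 'v edge set" where
  "cycle_edges vs =
     {e. \<exists>k < length vs. ends e = {vs ! k, vs ! (Suc k mod length vs)}}"

definition acyclic_edges :: "'v::card2 edge set \<Rightarrow> bool" where
  "acyclic_edges T \<longleftrightarrow>
     \<not> (\<exists>vs. 3 \<le> length vs \<and> distinct vs \<and> cycle_edges vs \<subseteq> T)"

definition adjacency :: "'v::card2 edge set \<Rightarrow> ('v \<times> 'v) set" where
  "adjacency T = {(i, j). \<exists>e \<in> T. ends e = {i, j}}"

definition spanning_tree :: "'v::card2 set \<Rightarrow> 'v edge set \<Rightarrow> bool" where
  "spanning_tree W T \<longleftrightarrow>
     (\<forall>e \<in> T. ends e \<subseteq> W) \<and>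
     (\<forall>i \<in> W. \<forall>j \<in> W. (i, j) \<in> (adjacency T)\<^sup>*) \<and>
     acyclic_edges T"

definition one_trees :: "'v::card2 \<Rightarrow> 'v edge set set" where
  "one_trees r = {U. \<exists>T e f. spanning_tree (- {r}) T \<and> e \<noteq> f \<and> r \<in> ends e \<and> r \<in> ends f \<and>
                       U = T \<union> {e, f}}"

definition hamiltonian_cycles :: "'v::card2 edge set set" where
  "hamiltonian_cycles =
     {cycle_edges vs | vs. 3 \<le> length vs \<and> distinct vs \<and> set vs = UNIV}"

definition non_tour_mass :: "'v::card2 \<Rightarrow> ('v edge set \<Rightarrow> real) \<Rightarrow> real" where
  "non_tour_mass r q = (\<Sum>U \<in> one_trees r - hamiltonian_cycles. q U)"

definition incidence :: "'v::card2 edge set \<Rightarrow> real ^ 'v edge" where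
  "incidence U = (\<chi> e. if e \<in> U then 1 else 0)"

definition degree_of :: "'v::card2 edge set \<Rightarrow> 'v \<Rightarrow> nat" where
  "degree_of U i = card {e \<in> U. i \<in> ends e}"

section \<open>The Gibbs law\<close>

definition partition_fun :: "real \<Rightarrow> 'v::card2 \<Rightarrow> real ^ 'v edge \<Rightarrow> real" where
  "partition_fun \<tau> r \<eta> = (\<Sum>U \<in> one_trees r. exp (- (1 / \<tau>) * (\<eta> \<bullet> incidence U)))"

definition gibbs :: "real \<Rightarrow> 'v::card2 \<Rightarrow> real ^ 'v edge \<Rightarrow> 'v edge set \<Rightarrow> real" where
  "gibbs \<tau> r \<eta> U = 1 / partition_fun \<tau> r \<eta> * exp (- (1 / \<tau>) * (\<eta> \<bullet> incidence U))"

definition expect ::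
    "'v::card2 \<Rightarrow> ('v edge set \<Rightarrow> real) \<Rightarrow> ('v edge set \<Rightarrow> 'a::real_vector) \<Rightarrow> 'a" where
  "expect r q f = (\<Sum>U \<in> one_trees r. q U *\<^sub>R f U)"

definition edge_mean :: "real \<Rightarrow> 'v::card2 \<Rightarrow> real ^ 'v edge \<Rightarrow> real ^ 'v edge" where
  "edge_mean \<tau> r \<eta> = expect r (gibbs \<tau> r \<eta>) incidence"

definition edge_cov :: "real \<Rightarrow> 'v::card2 \<Rightarrow> real ^ 'v edge \<Rightarrow> real ^ 'v edge ^ 'v edge" where
  "edge_cov \<tau> r \<eta> = (\<chi> e f. expect r (gibbs \<tau> r \<eta>)
      (\<lambda>U. (incidence U $ e - edge_mean \<tau> r \<eta> $ e) * (incidence U $ f - edge_mean \<tau> r \<eta> $ f)))"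

definition seminorm_of :: "real ^ 'e ^ 'e \<Rightarrow> real ^ 'e \<Rightarrow> real" where
  "seminorm_of S v = sqrt (v \<bullet> (S *v v))"

definition equilibrated :: "real \<Rightarrow> 'v::card2 \<Rightarrow> real ^ 'v edge \<Rightarrow> bool" where
  "equilibrated \<tau> r \<eta> \<longleftrightarrow>
     (\<forall>i. i \<noteq> r \<longrightarrow> expect r (gibbs \<tau> r \<eta>) (\<lambda>U. real (degree_of U i)) = 2)"

section \<open>Multipliers and the dual objective\<close>

text \<open>
  Multipliers indexed by the non-root vertices are represented as the vectors in \<open>real ^ 'v\<close>
  whose root coordinate vanishes, a subspace of dimension \<open>n - 1\<close>.
\<close>

definition multipliers :: "'v::card2 \<Rightarrow> (real, 'v) vec set" where
  "multipliers r = {l. l $ r = 0}"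

definition lift :: "'v::card2 \<Rightarrow> (real, 'v) vec \<Rightarrow> real ^ 'v edge" where
  "lift r l = (\<chi> e. \<Sum>i \<in> ends e - {r}. l $ i)"

text \<open>The root row of the degree matrix is padded with zeros.\<close>

definition degree_matrix :: "'v::card2 \<Rightarrow> (real ^ 'v edge, 'v) vec" where
  "degree_matrix r = (\<chi> i e. if i \<noteq> r \<and> i \<in> ends e then 1 else 0)"

lemma lift_eq_transpose: "lift r l = transpose (degree_matrix r) *v l"
  by (auto simp: vec_eq_iff lift_def degree_matrix_def transpose_def matrix_vector_mult_def
      if_distrib [of "\<lambda>x. x * _"] sum.If_cases intro!: sum.cong)

definition dual_objective :: "real \<Rightarrow> 'v::card2 \<Rightarrow> real ^ 'v edge \<Rightarrow> (real, 'v) vec \<Rightarrow> real" where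
  "dual_objective \<tau> r c l =
     - \<tau> * ln (partition_fun \<tau> r (c + lift r l)) - 2 * (\<Sum>i \<in> - {r}. l $ i)"

definition dual_maximizer :: "real \<Rightarrow> 'v::card2 \<Rightarrow> real ^ 'v edge \<Rightarrow> (real, 'v) vec \<Rightarrow> bool" where
  "dual_maximizer \<tau> r c l \<longleftrightarrow> is_arg_max (dual_objective \<tau> r c) (\<lambda>l. l \<in> multipliers r) l"

text \<open>
  Maximizers are not unique (adding the same constant to all non-root multipliers does not change
  the Gibbs law), so the map from inputs to maximizers is an arbitrary local selection.
\<close>

definition local_selection ::
    "real \<Rightarrow> 'v::card2 \<Rightarrow> real ^ 'v edge \<Rightarrow> (real ^ 'v edge \<Rightarrow> (real, 'v) vec) \<Rightarrow> bool" where
  "local_selection \<tau> r c lam \<longleftrightarrow>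
     (\<forall>\<^sub>F c' in nhds c. dual_maximizer \<tau> r c' (lam c')) \<and> lam differentiable (at c)"

definition equilibrate ::
    "'v::card2 \<Rightarrow> (real ^ 'v edge \<Rightarrow> (real, 'v) vec) \<Rightarrow> real ^ 'v edge \<Rightarrow> real ^ 'v edge" where
  "equilibrate r lam c = c + lift r (lam c)"

definition orth_proj :: "'a::euclidean_space set \<Rightarrow> 'a \<Rightarrow> 'a" where
  "orth_proj S x = (THE p. p \<in> S \<and> x - p \<in> S\<^sup>\<bottom>)"

section \<open>The Bernoulli certificate\<close>

definition edge_weight :: "'v::card2 \<Rightarrow> real ^ 'v edge" where
  "edge_weight r = (\<chi> e. 1 / 2 * (\<Sum>i \<in> - {r}. degree_matrix r $ i $ e))"

definition bernoulli_cert :: "'v::card2 \<Rightarrow> real ^ 'v edge \<Rightarrow> real" where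
  "bernoulli_cert r u = (\<Sum>e \<in> UNIV. edge_weight r $ e * u $ e * (1 - u $ e))"

definition bernoulli_grad :: "'v::card2 \<Rightarrow> real ^ 'v edge \<Rightarrow> real ^ 'v edge" where
  "bernoulli_grad r u = (\<chi> e. edge_weight r $ e * (1 - 2 * u $ e))"

lemma GDERIV_bernoulli_cert: "GDERIV (bernoulli_cert r) u :> bernoulli_grad r u"
proof -
  have coord: "((\<lambda>x :: real ^ 'a edge. x $ e) has_derivative (\<lambda>h. h $ e)) (at u)" for e
    by (rule bounded_linear.has_derivative[OF bounded_linear_vec_nth]) (rule has_derivative_ident)
  have "(bernoulli_cert r has_derivative
      (\<lambda>h. \<Sum>e \<in> UNIV. edge_weight r $ e * h $ e * (1 - u $ e) - edge_weight r $ e * u $ e * h $ e)) (at u)"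
    unfolding bernoulli_cert_def
    by (auto intro!: derivative_eq_intros coord ext sum.cong simp: algebra_simps)
  then show ?thesis
    unfolding gderiv_def
    by (rule has_derivative_eq_rhs)
      (auto simp: fun_eq_iff bernoulli_grad_def inner_vec_def algebra_simps intro!: sum.cong)
qed

end

theory Submission
  imports Defs
begin

text \<open>
  Split a one-tree into its tree \<open>T\<close> off the root and its pair \<open>R\<close> of root edges, which are independent
  under the Gibbs law. Let \<open>\<mu>\<close> be the edge marginals and write \<open>u v\<close> for the marginal of the edge \<open>r v\<close>
  and \<open>t v\<close> for the degree of \<open>v\<close> in \<open>T\<close>; at equilibrium the mean of \<open>t v\<close> is \<open>2 - u v\<close>, and \<open>u\<close>
  sums to 2. Hence the certificate is the mean over \<open>T\<close> of
  \<open>(\<Sum>e \<in> T. 1 - \<mu> e) + 1 - 1 / 2 * (\<Sum>v. (2 - t v) * u v)\<close>, and this expression already bounds the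
  conditional probability, given \<open>T\<close>, that the one-tree is not a tour. If some \<open>t k \<ge> 3\<close>, comparing
  \<open>t k\<close> with its mean bounds the first sum below by 1, and \<open>1 / 2 * (\<Sum>v. (2 - t v) * u v) \<le> 1\<close>
  because \<open>t v \<ge> 1\<close>. Otherwise \<open>T\<close> is a path with leaves \<open>a\<close> and \<open>b\<close>, the
  non-tour probability is at most \<open>2 - u a - u b\<close>, and comparing the degrees of the leaves with their
  means bounds the first sum below by \<open>1 - (u a + u b) / 2\<close>. No negative correlation of tree edges
  is used.

  For the sharpening step, let \<open>\<Sigma>\<close> be the edge covariance and \<open>D\<close> the derivative of the equilibrated
  edge input. The derivative of the edge means is \<open>- \<Sigma> D / \<tau>\<close>, and the equilibrium conditions make
  \<open>\<Sigma> D\<close> orthogonal to the range of the lift. So \<open>x \<bullet> \<Sigma> D y\<close> is the symmetric form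
  \<open>D x \<bullet> \<Sigma> D y\<close>, which vanishes when either argument lies in that range, and the derivative of the
  certificate along \<open>b\<close> is \<open>- 1 / \<tau>\<close> times its value at the projection of \<open>b\<close>.
\<close>

section \<open>Spanning trees of maximum degree two\<close>

lemma card_ends [simp]: "card (ends e) = 2"
  using ends[of e] by simp

lemma ends_Abs_edge [simp]: "x \<noteq> y \<Longrightarrow> ends (Abs_edge {x, y}) = {x, y}"
  by (simp add: Abs_edge_inverse)

lemma edge_eqI: "ends e = ends f \<Longrightarrow> e = f"
  by (simp add: ends_inject)

lemma ends_cases:
  obtains x y where "ends e = {x, y}" "x \<noteq> y"
proof -
  from card_ends[of e] show ?thesis unfolding card_2_iff by (elim exE conjE) (rule that)
qed

definition path_edges :: "'v::card2 list \<Rightarrow> 'v edge set" where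
  "path_edges vs = {e. \<exists>k. Suc k < length vs \<and> ends e = {vs ! k, vs ! Suc k}}"

text \<open>Take a longest path in \<open>T\<close>. The degree bound forbids leaving it,
  connectivity then makes it visit all of \<open>W\<close>, and acyclicity excludes every edge of
  \<open>T\<close> other than its own.\<close>

lemma bounded_degree_tree_is_path:
  fixes W :: "'v::card2 set"
  assumes tree: "spanning_tree W T" and W: "W \<noteq> {}"
    and deg: "\<And>v. v \<in> W \<Longrightarrow> degree_of T v \<le> 2"
  obtains vs where "distinct vs" "set vs = W" "T = path_edges vs"
proof -
  define P where "P vs \<longleftrightarrow> vs \<noteq> [] \<and> distinct vs \<and> set vs \<subseteq> W \<and>
      (\<forall>k. Suc k < length vs \<longrightarrow> (\<exists>e\<in>T. ends e = {vs ! k, vs ! Suc k}))" for vs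
  from W obtain w where "w \<in> W" by blast
  then have "P [w]" by (simp add: P_def)
  \<comment> \<open>A distinct list has at most \<open>CARD('v)\<close> entries, so path lengths are
    bounded and a longest path exists.\<close>
  moreover have "\<forall>vs. P vs \<longrightarrow> length vs < Suc (CARD('v))"
    by (metis P_def card_mono distinct_card finite less_Suc_eq_le subset_UNIV)
  ultimately obtain vs where P: "P vs" and max: "\<And>us. P us \<Longrightarrow> length us \<le> length vs"
    using ex_has_greatest_nat[of P "[w]" length] by blast
  from P have ne: "vs \<noteq> []" and dist: "distinct vs" and sub: "set vs \<subseteq> W"
    and adj: "\<And>k. Suc k < length vs \<Longrightarrow> \<exists>e\<in>T. ends e = {vs ! k, vs ! Suc k}"
    by (auto simp: P_def)
  have TW: "\<And>e. e \<in> T \<Longrightarrow> ends e \<subseteq> W" and ac: "acyclic_edges T"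
    and conn: "\<And>i j. i \<in> W \<Longrightarrow> j \<in> W \<Longrightarrow> (i, j) \<in> (adjacency T)\<^sup>*"
    using tree by (auto simp: spanning_tree_def)
  \<comment> \<open>A neighbour off the path would extend it at an end, against maximality, or give
    an inner vertex a third edge besides those to its predecessor and successor.\<close>
  have closed: "y \<in> set vs" if x: "x \<in> set vs" and xy: "(x, y) \<in> adjacency T" for x y
  proof (rule ccontr)
    assume y: "y \<notin> set vs"
    obtain e where e: "e \<in> T" "ends e = {x, y}"
      using xy by (auto simp: adjacency_def)
    then have yW: "y \<in> W" using TW by blast
    obtain k where k: "k < length vs" "vs ! k = x"
      using x by (auto simp: in_set_conv_nth)
    consider "k = 0" | "Suc k = length vs" | "k \<noteq> 0" "Suc k < length vs"
      using k by linarith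
    then show False
    proof cases
      case 1
      have "P (y # vs)"
        unfolding P_def
      proof (intro conjI allI impI)
        fix j assume "Suc j < length (y # vs)"
        then show "\<exists>e\<in>T. ends e = {(y # vs) ! j, (y # vs) ! Suc j}"
          using adj e 1 k by (cases j) (auto simp: insert_commute)
      qed (use y dist sub yW in auto)
      then show False using max by fastforce
    next
      case 2
      have "P (vs @ [y])"
        unfolding P_def
      proof (intro conjI allI impI)
        fix j assume j: "Suc j < length (vs @ [y])"
        show "\<exists>e\<in>T. ends e = {(vs @ [y]) ! j, (vs @ [y]) ! Suc j}"
        proof (cases "Suc j < length vs")
          case True
          then show ?thesis using adj[of j] by (simp add: nth_append)
        next
          case False
          then have "j = k" using j 2 by simp
          then show ?thesis using e 2 k by (auto simp: nth_append)
        qed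
      qed (use y dist sub yW in auto)
      then show False using max by fastforce
    next
      case 3
      then obtain j where j: "k = Suc j" by (cases k) auto
      obtain f where f: "f \<in> T" "ends f = {vs ! j, x}"
        using adj[of j] j k by auto
      obtain g where g: "g \<in> T" "ends g = {x, vs ! Suc k}"
        using adj[of k] 3 k by auto
      have ne': "vs ! j \<noteq> vs ! Suc k" "vs ! j \<noteq> x" "x \<noteq> vs ! Suc k"
        using dist j 3 k by (auto simp: nth_eq_iff_index_eq)
      have "y \<noteq> vs ! j" "y \<noteq> vs ! Suc k" using y j 3 k by auto
      then have "e \<noteq> f" "e \<noteq> g" "f \<noteq> g"
        using e f g ne' by (metis doubleton_eq_iff)+
      then have "card {e, f, g} = 3" by simp
      moreover have "{e, f, g} \<subseteq> {e \<in> T. x \<in> ends e}" using e f g by auto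
      then have "card {e, f, g} \<le> degree_of T x"
        unfolding degree_of_def by (intro card_mono) auto
      ultimately show False using deg[of x] x sub by auto
    qed
  qed
  have "set vs = W"
  proof (intro equalityI sub subsetI)
    fix w assume w: "w \<in> W"
    have "hd vs \<in> W" using ne sub by auto
    from conn[OF this w] show "w \<in> set vs"
    proof (induction rule: rtrancl_induct)
      case base
      show ?case using ne by simp
    next
      case (step y z)
      then show ?case using closed by blast
    qed
  qed
  moreover have "T = path_edges vs"
  proof (intro equalityI subsetI)
    fix e assume "e \<in> path_edges vs"
    then obtain k where "Suc k < length vs" "ends e = {vs ! k, vs ! Suc k}"
      by (auto simp: path_edges_def)
    then obtain f where "f \<in> T" "ends f = ends e" using adj[of k] by auto
    then show "e \<in> T" by (simp add: ends_inject)
  next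
    fix e assume e: "e \<in> T"
    obtain x y where xy: "ends e = {x, y}" "x \<noteq> y" by (rule ends_cases)
    have "x \<in> set vs" "y \<in> set vs" using TW[OF e] xy \<open>set vs = W\<close> by auto
    then obtain k' l' where "k' < length vs" "vs ! k' = x" "l' < length vs" "vs ! l' = y"
      by (auto simp: in_set_conv_nth)
    with xy obtain k l where kl: "k < l" "l < length vs" "ends e = {vs ! k, vs ! l}"
      by (metis insert_commute linorder_neqE_nat)
    show "e \<in> path_edges vs"
    proof (cases "l = Suc k")
      case True
      then show ?thesis using kl by (auto simp: path_edges_def)
    next
      case False
      \<comment> \<open>An edge of \<open>T\<close> joining non-consecutive positions
        \<open>k < l\<close> closes the segment between them into a cycle;
        \<open>l \<noteq> Suc k\<close> gives it at least three vertices.\<close>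
      define us where "us = take (Suc l - k) (drop k vs)"
      have len: "length us = Suc l - k" using kl by (simp add: us_def)
      have nth: "us ! j = vs ! (k + j)" if "j < length us" for j
        using that kl len by (simp add: us_def)
      have "cycle_edges us \<subseteq> T"
      proof
        fix f assume "f \<in> cycle_edges us"
        then obtain j where j: "j < length us" "ends f = {us ! j, us ! (Suc j mod length us)}"
          by (auto simp: cycle_edges_def)
        show "f \<in> T"
        proof (cases "Suc j < length us")
          case True
          then have "ends f = {vs ! (k + j), vs ! Suc (k + j)}" using j nth by simp
          moreover have "Suc (k + j) < length vs" using True len kl by simp
          ultimately obtain g where "g \<in> T" "ends g = ends f" using adj[of "k + j"] by auto
          then show ?thesis by (simp add: ends_inject)
        next
          \<comment> \<open>The wrap-around edge of this cycle is the chord \<open>e\<close>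
            itself.\<close>
          case False
          then have "Suc j = length us" using j by simp
          then have "k + j = l" using len kl by simp
          then have "ends f = {vs ! l, vs ! k}"
            using j nth[of j] nth[of 0] \<open>Suc j = length us\<close> by fastforce
          then have "ends e = ends f" using kl by (simp add: insert_commute)
          then show ?thesis using e by (simp add: ends_inject)
        qed
      qed
      moreover have "distinct us" using dist by (simp add: us_def)
      moreover have "3 \<le> length us" using len kl False by simp
      ultimately show ?thesis using ac by (auto simp: acyclic_edges_def)
    qed
  qed
  ultimately show thesis using dist that by blast
qed

section \<open>Size and end degrees of a path, and its closure through the root\<close>

lemma card_path_edges:
  assumes "distinct vs"
  shows "card (path_edges vs) = length vs - 1"
proof -
  have ne: "vs ! k \<noteq> vs ! Suc k" if "k < length vs - 1" for k
    using assms that by (simp add: nth_eq_iff_index_eq)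
  have "path_edges vs = (\<lambda>k. Abs_edge {vs ! k, vs ! Suc k}) ` {..<length vs - 1}"
  proof (intro equalityI subsetI)
    fix e assume "e \<in> path_edges vs"
    then obtain k where k: "Suc k < length vs" "ends e = {vs ! k, vs ! Suc k}"
      by (auto simp: path_edges_def)
    then have "e = Abs_edge {vs ! k, vs ! Suc k}" using ends_inverse[of e] by simp
    then show "e \<in> (\<lambda>k. Abs_edge {vs ! k, vs ! Suc k}) ` {..<length vs - 1}"
      using k(1) by (intro image_eqI) auto
  next
    fix e assume "e \<in> (\<lambda>k. Abs_edge {vs ! k, vs ! Suc k}) ` {..<length vs - 1}"
    then obtain k where "k < length vs - 1" "e = Abs_edge {vs ! k, vs ! Suc k}" by auto
    then show "e \<in> path_edges vs" using ne[of k] by (auto simp: path_edges_def intro!: exI[of _ k])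
  qed
  moreover have "inj_on (\<lambda>k. Abs_edge {vs ! k, vs ! Suc k}) {..<length vs - 1}"
  proof (rule inj_onI)
    fix j k assume *: "j \<in> {..<length vs - 1}" "k \<in> {..<length vs - 1}"
      and "Abs_edge {vs ! j, vs ! Suc j} = Abs_edge {vs ! k, vs ! Suc k}"
    then have "{vs ! j, vs ! Suc j} = {vs ! k, vs ! Suc k}"
      using ne[of j] ne[of k] by (metis ends_Abs_edge lessThan_iff)
    then show "j = k"
      using * assms by (auto simp: doubleton_eq_iff nth_eq_iff_index_eq)
  qed
  ultimately show ?thesis by (simp add: card_image)
qed

text \<open>In a distinct list only the edge at index 0 can touch the head. The bound is not an
  equality because a one-vertex path has no edge.\<close>

lemma degree_path_edges_first:
  assumes "distinct vs" "vs \<noteq> []"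
  shows "degree_of (path_edges vs) (hd vs) \<le> 1"
proof -
  have ends: "ends e = {vs ! 0, vs ! 1}" if e: "e \<in> path_edges vs" "hd vs \<in> ends e" for e
  proof -
    obtain k where k: "Suc k < length vs" "ends e = {vs ! k, vs ! Suc k}"
      using e(1) by (auto simp: path_edges_def)
    moreover have "vs ! 0 = vs ! k \<or> vs ! 0 = vs ! Suc k"
      using e(2) k(2) assms(2) by (simp add: hd_conv_nth)
    then have "k = 0"
      using assms k(1) by (metis Suc_lessD gr_implies_not0 length_greater_0_conv
          nat.distinct(1) nth_eq_iff_index_eq)
    ultimately show ?thesis by simp
  qed
  have "\<forall>e \<in> {e \<in> path_edges vs. hd vs \<in> ends e}. \<forall>f \<in> {e \<in> path_edges vs. hd vs \<in> ends e}. e = f"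
  proof (intro ballI edge_eqI)
    fix e f assume "e \<in> {e \<in> path_edges vs. hd vs \<in> ends e}" "f \<in> {e \<in> path_edges vs. hd vs \<in> ends e}"
    then show "ends e = ends f" using ends[of e] ends[of f] by simp
  qed
  then show ?thesis unfolding degree_of_def One_nat_def
    by (subst card_le_Suc0_iff_eq) simp_all
qed

lemma path_edges_rev: "path_edges (rev vs) = path_edges vs"
proof -
  have "path_edges vs \<subseteq> path_edges (rev vs)" for vs :: "'a list"
  proof
    fix e assume "e \<in> path_edges vs"
    then obtain k where k: "Suc k < length vs" "ends e = {vs ! k, vs ! Suc k}"
      by (auto simp: path_edges_def)
    let ?j = "length vs - Suc (Suc k)"
    have "rev vs ! ?j = vs ! Suc k" "rev vs ! Suc ?j = vs ! k"
      using k by (auto simp: rev_nth Suc_diff_Suc)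
    then show "e \<in> path_edges (rev vs)"
      using k unfolding path_edges_def
      by (auto intro!: exI[of _ ?j] simp: insert_commute)
  qed
  from this[of vs] this[of "rev vs"] show ?thesis by auto
qed

lemma degree_path_edges_last:
  assumes "distinct vs" "vs \<noteq> []"
  shows "degree_of (path_edges vs) (last vs) \<le> 1"
  using degree_path_edges_first[of "rev vs"] assms by (simp add: path_edges_rev hd_rev)

text \<open>With the root first, index 0 and the wrap-around index give the two root edges; every
  other index is a path index shifted by one.\<close>

lemma cycle_edges_Cons:
  assumes "vs \<noteq> []" "r \<notin> set vs"
  shows "cycle_edges (r # vs) = path_edges vs \<union> {Abs_edge {r, hd vs}, Abs_edge {r, last vs}}"
    (is "?L = ?R")
proof (intro equalityI subsetI)
  have r: "r \<noteq> hd vs" "r \<noteq> last vs" using assms by auto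
  have lst: "(r # vs) ! length vs = last vs" using assms by (simp add: last_conv_nth nth_Cons')
  have hd: "vs ! 0 = hd vs" using assms by (simp add: hd_conv_nth)
  { fix e assume "e \<in> ?L"
    then obtain k where k: "k < Suc (length vs)"
        "ends e = {(r # vs) ! k, (r # vs) ! (Suc k mod Suc (length vs))}"
      by (auto simp: cycle_edges_def)
    then consider "k = 0" | "k = length vs" | "k \<noteq> 0" "k < length vs" by linarith
    then show "e \<in> ?R"
    proof cases
      case 1
      then have "ends e = ends (Abs_edge {r, hd vs})" using k r hd assms by simp
      then show ?thesis by (simp add: ends_inject)
    next
      case 2
      then have "ends e = ends (Abs_edge {r, last vs})" using k r lst by (simp add: insert_commute)
      then show ?thesis by (simp add: ends_inject)
    next
      case 3
      then obtain j where "k = Suc j" by (cases k) simp_all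
      then have "Suc j < length vs" "ends e = {vs ! j, vs ! Suc j}" using k 3 by simp_all
      then show ?thesis by (auto simp: path_edges_def)
    qed }
  { fix e assume "e \<in> ?R"
    then consider "e \<in> path_edges vs" | "e = Abs_edge {r, hd vs}" | "e = Abs_edge {r, last vs}"
      by blast
    then show "e \<in> ?L"
    proof cases
      case 1
      then obtain k where "Suc k < length vs" "ends e = {vs ! k, vs ! Suc k}"
        by (auto simp: path_edges_def)
      then show ?thesis unfolding cycle_edges_def mem_Collect_eq
        by (intro exI[of _ "Suc k"]) simp
    next
      case 2
      then have "ends e = {(r # vs) ! 0, (r # vs) ! Suc 0}" using r hd by simp
      then show ?thesis using assms unfolding cycle_edges_def mem_Collect_eq
        by (intro exI[of _ 0]) simp
    next
      case 3
      then have "ends e = {(r # vs) ! length vs, (r # vs) ! 0}"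
        using r lst by (simp add: insert_commute)
      then show ?thesis unfolding cycle_edges_def mem_Collect_eq
        by (intro exI[of _ "length vs"]) simp
    qed }
qed

section \<open>Splitting a one-tree at the root\<close>

definition trees :: "'v::card2 \<Rightarrow> 'v edge set set" where
  "trees r = {T. spanning_tree (- {r}) T}"

text \<open>Unordered pairs are taken so that a one-tree determines its root pair and no one-tree is
  counted twice.\<close>

definition root_pairs :: "'v::card2 \<Rightarrow> 'v edge set set" where
  "root_pairs r = {R. R \<subseteq> {e. r \<in> ends e} \<and> card R = 2}"

abbreviation root_edge :: "'v::card2 \<Rightarrow> 'v \<Rightarrow> 'v edge" where
  "root_edge r v \<equiv> Abs_edge {r, v}"

lemma tree_edge_avoids_root: "T \<in> trees r \<Longrightarrow> e \<in> T \<Longrightarrow> r \<notin> ends e"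
  unfolding trees_def spanning_tree_def by blast

lemma root_pair_edge: "R \<in> root_pairs r \<Longrightarrow> e \<in> R \<Longrightarrow> r \<in> ends e"
  unfolding root_pairs_def by blast

lemma bij_betw_root_edge: "bij_betw (root_edge r) (- {r}) {e. r \<in> ends e}"
proof (rule bij_betwI[of _ _ _ "\<lambda>e. the_elem (ends e - {r})"])
  show "root_edge r \<in> - {r} \<rightarrow> {e. r \<in> ends e}"
    by auto
  have *: "\<exists>v. v \<noteq> r \<and> ends e = {r, v}" if "r \<in> ends e" for e :: "'a edge"
    using that card_ends[of e] unfolding card_2_iff by auto
  show "(\<lambda>e. the_elem (ends e - {r})) \<in> {e. r \<in> ends e} \<rightarrow> - {r}"
  proof
    fix e :: "'a edge" assume "e \<in> {e. r \<in> ends e}"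
    then obtain v where "v \<noteq> r" "ends e = {r, v}" using * by blast
    moreover from this have "ends e - {r} = {v}" by auto
    ultimately show "the_elem (ends e - {r}) \<in> - {r}" by simp
  qed
  show "the_elem (ends (root_edge r v) - {r}) = v" if "v \<in> - {r}" for v
  proof -
    have "ends (root_edge r v) - {r} = {v}" using that by auto
    then show ?thesis by simp
  qed
  show "root_edge r (the_elem (ends e - {r})) = e" if e: "e \<in> {e. r \<in> ends e}" for e
  proof -
    obtain v where v: "v \<noteq> r" "ends e = {r, v}" using * e by blast
    moreover from this have "ends e - {r} = {v}" by auto
    ultimately show ?thesis using ends_inverse[of e] by simp
  qed
qed

text \<open>Whether an edge meets \<open>r\<close> tells which part it came from, so
  \<open>T\<close> and \<open>R\<close> can be recovered from \<open>T \<union> R\<close> and the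
  sum factors over independent choices.\<close>

lemma sum_one_trees:
  fixes f :: "'v::card2 edge set \<Rightarrow> 'a::comm_monoid_add"
  shows "(\<Sum>U \<in> one_trees r. f U) = (\<Sum>T \<in> trees r. \<Sum>R \<in> root_pairs r. f (T \<union> R))"
proof -
  have "inj_on (\<lambda>(T, R). T \<union> R) (trees r \<times> root_pairs r)"
  proof (rule inj_onI, clarify)
    fix T R T' R'
    assume *: "T \<in> trees r" "R \<in> root_pairs r" "T' \<in> trees r" "R' \<in> root_pairs r" "T \<union> R = T' \<union> R'"
    have "T = {e \<in> T \<union> R. r \<notin> ends e}" "R = {e \<in> T \<union> R. r \<in> ends e}"
      using * tree_edge_avoids_root root_pair_edge by blast+
    moreover have "T' = {e \<in> T' \<union> R'. r \<notin> ends e}" "R' = {e \<in> T' \<union> R'. r \<in> ends e}"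
      using * tree_edge_avoids_root root_pair_edge by blast+
    ultimately show "T = T' \<and> R = R'" using *(5) by auto
  qed
  moreover have "one_trees r = (\<lambda>(T, R). T \<union> R) ` (trees r \<times> root_pairs r)"
  proof (intro equalityI subsetI)
    fix U assume "U \<in> one_trees r"
    then obtain T e f where "spanning_tree (- {r}) T" "e \<noteq> f" "r \<in> ends e" "r \<in> ends f"
      "U = T \<union> {e, f}" unfolding one_trees_def by blast
    then show "U \<in> (\<lambda>(T, R). T \<union> R) ` (trees r \<times> root_pairs r)"
      by (intro image_eqI[of _ _ "(T, {e, f})"]) (auto simp: trees_def root_pairs_def)
  next
    fix U assume "U \<in> (\<lambda>(T, R). T \<union> R) ` (trees r \<times> root_pairs r)"
    then obtain T R where "U = T \<union> R" "T \<in> trees r" "R \<subseteq> {e. r \<in> ends e}" "card R = 2"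
      by (auto simp: root_pairs_def)
    then show "U \<in> one_trees r"
      unfolding one_trees_def trees_def card_2_iff by blast
  qed
  ultimately show ?thesis
    by (simp add: sum.reindex sum.cartesian_product case_prod_unfold)
qed

section \<open>Degrees in a one-tree and in its tree part\<close>

lemma degree_of_eq_sum: "real (degree_of T v) = (\<Sum>e | v \<in> ends e. of_bool (e \<in> T))"
proof -
  have "{e. v \<in> ends e} \<inter> {e. e \<in> T} = {e \<in> T. v \<in> ends e}" by auto
  then show ?thesis by (simp add: degree_of_def)
qed

text \<open>An edge of \<open>R\<close> meets \<open>r\<close>, so the only one that can also meet
  \<open>v\<close> is \<open>root_edge r v\<close>.\<close>

lemma degree_of_Un_root_pair:
  assumes "T \<in> trees r" "R \<in> root_pairs r" "v \<noteq> r"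
  shows "real (degree_of (T \<union> R) v) = real (degree_of T v) + of_bool (root_edge r v \<in> R)"
proof -
  have *: "e = root_edge r v" if "e \<in> R" "v \<in> ends e" for e
  proof -
    have "{r, v} \<subseteq> ends e" using root_pair_edge[OF assms(2) that(1)] that(2) by simp
    moreover have "card {r, v} = card (ends e)" using assms(3) by simp
    ultimately have "{r, v} = ends e" by (intro card_subset_eq) simp_all
    then show ?thesis using ends_inverse[of e] by simp
  qed
  have in_ends: "v \<in> ends (root_edge r v)" using assms(3) by simp
  have notin: "root_edge r v \<notin> T"
    using tree_edge_avoids_root[OF assms(1), of "root_edge r v"] assms(3) by auto
  show ?thesis
  proof (cases "root_edge r v \<in> R")
    case True
    then have "{e \<in> T \<union> R. v \<in> ends e} = insert (root_edge r v) {e \<in> T. v \<in> ends e}"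
      using * in_ends by blast
    then show ?thesis using True notin by (simp add: degree_of_def)
  next
    case False
    then have "{e \<in> T \<union> R. v \<in> ends e} = {e \<in> T. v \<in> ends e}"
      using * by blast
    then show ?thesis using False by (simp add: degree_of_def)
  qed
qed

text \<open>Handshake count: tree edges avoid the root, so the sum over non-root vertices sees both
  ends of each.\<close>

lemma sum_degree_of_tree:
  assumes "T \<in> trees r"
  shows "(\<Sum>v \<in> - {r}. degree_of T v) = 2 * card T"
proof -
  have "(\<Sum>v \<in> - {r}. degree_of T v) = (\<Sum>v \<in> - {r}. \<Sum>e \<in> T. of_bool (v \<in> ends e))"
    by (simp add: degree_of_def Int_def)
  also have "\<dots> = (\<Sum>e \<in> T. \<Sum>v \<in> - {r}. of_bool (v \<in> ends e))"
    by (rule sum.swap)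
  also have "\<dots> = (\<Sum>e \<in> T. card (ends e))"
  proof (rule sum.cong[OF refl])
    fix e assume "e \<in> T"
    then have "- {r} \<inter> {v. v \<in> ends e} = ends e"
      using tree_edge_avoids_root[OF assms] by auto
    then show "(\<Sum>v \<in> - {r}. of_bool (v \<in> ends e)) = card (ends e)"
      by simp
  qed
  finally show ?thesis by simp
qed

text \<open>With three vertices there is a second non-root vertex, and the first edge on a walk to
  it is incident to \<open>v\<close>.\<close>

lemma degree_of_tree_pos:
  assumes "T \<in> trees r" "v \<noteq> r" "3 \<le> CARD('v)"
  shows "1 \<le> degree_of T (v :: 'v::card2)"
proof -
  have "\<exists>w. w \<notin> {r, v}"
  proof (rule ccontr)
    assume "\<not> (\<exists>w. w \<notin> {r, v})"
    then have "(UNIV :: 'v set) \<subseteq> {r, v}" by blast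
    then have "CARD('v) \<le> card {r, v}" by (intro card_mono) auto
    then show False using assms(2,3) by simp
  qed
  then obtain w where "w \<noteq> r" "w \<noteq> v" by blast
  then have "(v, w) \<in> (adjacency T)\<^sup>*"
    using assms(1,2) by (auto simp: trees_def spanning_tree_def)
  then obtain x where "(v, x) \<in> adjacency T" using \<open>w \<noteq> v\<close> by (metis converse_rtranclE)
  then have "{e \<in> T. v \<in> ends e} \<noteq> {}" by (auto simp: adjacency_def)
  then show ?thesis unfolding degree_of_def by (simp add: Suc_le_eq card_gt_0_iff)
qed

text \<open>The weight is half the number of non-root endpoints.\<close>

lemma edge_weight_eq: "edge_weight r $ e = (if r \<in> ends e then 1 / 2 else 1)"
proof -
  have "(\<Sum>i \<in> - {r}. degree_matrix r $ i $ e) = real (card (ends e - {r}))"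
  proof -
    have "(\<Sum>i \<in> - {r}. degree_matrix r $ i $ e) = (\<Sum>i \<in> ends e - {r}. 1)"
      by (intro sum.mono_neutral_cong_right) (auto simp: degree_matrix_def)
    then show ?thesis by simp
  qed
  then show ?thesis by (simp add: edge_weight_def card_Diff_singleton_if)
qed

text \<open>Without a branching vertex the tree is a path, and joining its two ends to the root
  completes it to a tour. Three vertices make the two ends distinct.\<close>

lemma tree_cases:
  assumes T: "T \<in> trees r" and n: "3 \<le> CARD('v::card2)"
  obtains (branching) k where "k \<noteq> r" "3 \<le> degree_of T (k :: 'v)"
  | (path) a b where "a \<noteq> r" "b \<noteq> r" "a \<noteq> b" "degree_of T a \<le> 1" "degree_of T b \<le> 1"
      "\<And>v. v \<notin> {r, a, b} \<Longrightarrow> 2 \<le> degree_of T v" "card T = CARD('v) - 2"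
      "T \<union> {root_edge r a, root_edge r b} \<in> hamiltonian_cycles"
proof (cases "\<exists>k. k \<noteq> r \<and> 3 \<le> degree_of T k")
  case True
  then show ?thesis using branching by blast
next
  case False
  have "spanning_tree (- {r}) T" using T by (simp add: trees_def)
  moreover have "- {r} \<noteq> {}"
  proof
    assume "- {r} = {}"
    then have "UNIV = {r}" by blast
    then have "CARD('v) = card {r}" by simp
    then show False using n by simp
  qed
  moreover have deg: "degree_of T v \<le> 2" if "v \<in> - {r}" for v
  proof (rule ccontr)
    assume "\<not> degree_of T v \<le> 2"
    then have "v \<noteq> r \<and> 3 \<le> degree_of T v" using that by auto
    then show False using False by blast
  qed
  ultimately obtain vs where vs: "distinct vs" "set vs = - {r}" "T = path_edges vs"
    using bounded_degree_tree_is_path by metis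
  have len: "length vs = CARD('v) - 1"
    using distinct_card[OF vs(1)] vs(2) by (simp add: Compl_eq_Diff_UNIV card_Diff_singleton)
  then have ne: "vs \<noteq> []" using n by auto
  have "hd vs \<in> set vs" "last vs \<in> set vs" using ne by auto
  then have hr: "hd vs \<noteq> r" and lr: "last vs \<noteq> r" using vs(2) by auto
  moreover have hl: "hd vs \<noteq> last vs"
    using len n ne vs(1) by (simp add: hd_conv_nth last_conv_nth nth_eq_iff_index_eq)
  moreover have "T \<union> {root_edge r (hd vs), root_edge r (last vs)} = cycle_edges (r # vs)"
    using cycle_edges_Cons[OF ne, of r] vs by simp
  then have "T \<union> {root_edge r (hd vs), root_edge r (last vs)} \<in> hamiltonian_cycles"
    unfolding hamiltonian_cycles_def using vs len n by (intro CollectI exI[of _ "r # vs"]) auto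
  moreover have card_T: "card T = CARD('v) - 2" using card_path_edges[OF vs(1)] len vs(3) by simp
  moreover have d: "degree_of T (hd vs) \<le> 1" "degree_of T (last vs) \<le> 1"
    using degree_path_edges_first[OF vs(1) ne] degree_path_edges_last[OF vs(1) ne] vs(3) by simp_all
  moreover have "2 \<le> degree_of T v" if v: "v \<notin> {r, hd vs, last vs}" for v
  proof -
    \<comment> \<open>The deficits \<open>2 - degree\<close> are nonnegative and total
      \<open>2 * (n - 1) - 2 * (n - 2) = 2\<close>. Each end already takes at least 1, so nothing
      positive remains for \<open>v\<close>.\<close>
    have "(\<Sum>w \<in> {v, hd vs, last vs}. 2 - real (degree_of T w)) \<le> (\<Sum>w \<in> - {r}. 2 - real (degree_of T w))"
    proof (rule sum_mono2)
      show "0 \<le> 2 - real (degree_of T w)" if "w \<in> - {r} - {v, hd vs, last vs}" for w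
        using deg[of w] that by simp
    qed (use v hr lr in auto)
    also have "\<dots> = 2 * real (card (- {r})) - 2 * real (card T)"
      using arg_cong[OF sum_degree_of_tree[OF T], of real] by (simp add: sum_subtractf)
    also have "\<dots> = 2"
      using card_T n by (simp add: Compl_eq_Diff_UNIV card_Diff_singleton of_nat_diff)
    finally show ?thesis using v hl d by simp
  qed
  ultimately show ?thesis
    using path[of "hd vs" "last vs"] by simp
qed

section \<open>Independent trees and root pairs\<close>

text \<open>Abstracts from the Gibbs law what the certificate rests on: a tree and a root pair drawn
  independently from \<open>p\<close> and \<open>\<rho>\<close>, with mean degree 2 at every
  non-root vertex.\<close>

locale one_tree_product_law =
  fixes r :: "'v::card2" and p \<rho> :: "'v edge set \<Rightarrow> real"
  assumes card3: "3 \<le> CARD('v)"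
    and p_nonneg: "\<And>T. 0 \<le> p T" and p_sum: "(\<Sum>T \<in> trees r. p T) = 1"
    and rho_nonneg: "\<And>R. 0 \<le> \<rho> R" and rho_sum: "(\<Sum>R \<in> root_pairs r. \<rho> R) = 1"
    and mean_degree: "\<And>v. v \<noteq> r \<Longrightarrow>
      (\<Sum>T \<in> trees r. \<Sum>R \<in> root_pairs r. p T * \<rho> R * real (degree_of (T \<union> R) v)) = 2"
begin

text \<open>Both marginals are defined on all edges and each vanishes on the edges of the other
  kind, so that their sum is the full edge marginal.\<close>

definition tree_marginal :: "'v edge \<Rightarrow> real" where
  "tree_marginal e = (\<Sum>T \<in> trees r. p T * of_bool (e \<in> T))"

definition root_marginal :: "'v edge \<Rightarrow> real" where
  "root_marginal e = (\<Sum>R \<in> root_pairs r. \<rho> R * of_bool (e \<in> R))"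

lemma tree_marginal_nonneg: "0 \<le> tree_marginal e"
  unfolding tree_marginal_def by (intro sum_nonneg mult_nonneg_nonneg p_nonneg) auto

lemma tree_marginal_le_1: "tree_marginal e \<le> 1"
proof -
  have "tree_marginal e \<le> (\<Sum>T \<in> trees r. p T)"
    unfolding tree_marginal_def using p_nonneg by (intro sum_mono) (auto simp: of_bool_def)
  then show ?thesis by (simp add: p_sum)
qed

lemma root_marginal_nonneg: "0 \<le> root_marginal e"
  unfolding root_marginal_def by (intro sum_nonneg mult_nonneg_nonneg rho_nonneg) auto

lemma tree_marginal_root_edge: "r \<in> ends e \<Longrightarrow> tree_marginal e = 0"
  unfolding tree_marginal_def using tree_edge_avoids_root
  by (intro sum.neutral) (auto simp: of_bool_def)

lemma root_marginal_tree_edge: "r \<notin> ends e \<Longrightarrow> root_marginal e = 0"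
  unfolding root_marginal_def using root_pair_edge
  by (intro sum.neutral) (auto simp: of_bool_def)

lemma sum_root_marginal: "(\<Sum>v \<in> - {r}. root_marginal (root_edge r v)) = 2"
proof -
  have "(\<Sum>v \<in> - {r}. root_marginal (root_edge r v)) = (\<Sum>e | r \<in> ends e. root_marginal e)"
    by (rule sum.reindex_bij_betw[OF bij_betw_root_edge])
  also have "\<dots> = (\<Sum>R \<in> root_pairs r. \<Sum>e | r \<in> ends e. \<rho> R * of_bool (e \<in> R))"
    unfolding root_marginal_def by (rule sum.swap)
  also have "\<dots> = (\<Sum>R \<in> root_pairs r. \<rho> R * 2)"
  proof (rule sum.cong[OF refl])
    fix R assume R: "R \<in> root_pairs r"
    then have "{e. r \<in> ends e} \<inter> R = R" and card: "card R = 2"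
      unfolding root_pairs_def by blast+
    then have "(\<Sum>e | r \<in> ends e. of_bool (e \<in> R)) = (2 :: real)"
      by simp
    then show "(\<Sum>e | r \<in> ends e. \<rho> R * of_bool (e \<in> R)) = \<rho> R * 2"
      by (simp only: sum_distrib_left[symmetric])
  qed
  finally show ?thesis by (simp add: sum_distrib_right[symmetric] rho_sum)
qed

text \<open>Linearity of the mean over trees; the weight \<open>h = 1\<close> yields mean degrees
  and mean size, \<open>h = 1 - tree_marginal\<close> the mean defect.\<close>

lemma sum_tree_weighted:
  "(\<Sum>T \<in> trees r. p T * (\<Sum>e \<in> E. of_bool (e \<in> T) * h e)) = (\<Sum>e \<in> E. tree_marginal e * h e)"
proof -
  have "(\<Sum>T \<in> trees r. p T * (\<Sum>e \<in> E. of_bool (e \<in> T) * h e)) =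
      (\<Sum>T \<in> trees r. \<Sum>e \<in> E. p T * of_bool (e \<in> T) * h e)"
    by (simp only: sum_distrib_left mult.assoc)
  also have "\<dots> = (\<Sum>e \<in> E. \<Sum>T \<in> trees r. p T * of_bool (e \<in> T) * h e)"
    by (rule sum.swap)
  also have "\<dots> = (\<Sum>e \<in> E. tree_marginal e * h e)"
    by (simp only: tree_marginal_def sum_distrib_right)
  finally show ?thesis .
qed

lemma tree_mean_degree:
  "(\<Sum>T \<in> trees r. p T * real (degree_of T v)) = (\<Sum>e | v \<in> ends e. tree_marginal e)"
  unfolding degree_of_eq_sum using sum_tree_weighted[where E="{e. v \<in> ends e}" and h="\<lambda>_. 1"] by simp

lemma tree_mean_degree_eq:
  assumes "v \<noteq> r"
  shows "(\<Sum>T \<in> trees r. p T * real (degree_of T v)) = 2 - root_marginal (root_edge r v)"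
proof -
  have "2 = (\<Sum>T \<in> trees r. \<Sum>R \<in> root_pairs r. p T * \<rho> R * real (degree_of (T \<union> R) v))"
    using mean_degree[OF assms] by simp
  also have "\<dots> = (\<Sum>T \<in> trees r. \<Sum>R \<in> root_pairs r.
      p T * real (degree_of T v) * \<rho> R + p T * (\<rho> R * of_bool (root_edge r v \<in> R)))"
    by (intro sum.cong refl)
      (simp only: degree_of_Un_root_pair[OF _ _ assms] ring_distribs mult_ac)
  also have "\<dots> = (\<Sum>T \<in> trees r. p T * real (degree_of T v) + p T * root_marginal (root_edge r v))"
    unfolding sum.distrib sum_distrib_left[symmetric] rho_sum root_marginal_def by simp
  also have "\<dots> = (\<Sum>T \<in> trees r. p T * real (degree_of T v)) + root_marginal (root_edge r v)"
    unfolding sum.distrib sum_distrib_right[symmetric] p_sum by simp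
  finally show ?thesis by simp
qed

text \<open>The mean tree size follows from equilibrium by averaging the handshake count: the
  \<open>n - 1\<close> mean degrees are 2 minus root marginals, which sum to 2.\<close>

lemma sum_tree_marginal: "(\<Sum>e \<in> UNIV. tree_marginal e) = real CARD('v) - 2"
proof -
  have "(\<Sum>e \<in> UNIV. tree_marginal e) = (\<Sum>T \<in> trees r. p T * real (card T))"
    using sum_tree_weighted[where E=UNIV and h="\<lambda>_. 1"] by simp
  then have "2 * (\<Sum>e \<in> UNIV. tree_marginal e) = (\<Sum>T \<in> trees r. 2 * (p T * real (card T)))"
    by (simp only: sum_distrib_left)
  also have "\<dots> = (\<Sum>T \<in> trees r. p T * (2 * real (card T)))"
    by (intro sum.cong refl) simp
  also have "\<dots> = (\<Sum>T \<in> trees r. p T * (\<Sum>v \<in> - {r}. real (degree_of T v)))"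
  proof (intro sum.cong refl arg_cong2[of _ _ _ _ "(*)"])
    fix T assume "T \<in> trees r"
    from arg_cong[OF sum_degree_of_tree[OF this], of real]
    show "2 * real (card T) = (\<Sum>v \<in> - {r}. real (degree_of T v))" by simp
  qed
  also have "\<dots> = (\<Sum>v \<in> - {r}. \<Sum>T \<in> trees r. p T * real (degree_of T v))"
    unfolding sum_distrib_left by (rule sum.swap)
  also have "\<dots> = (\<Sum>v \<in> - {r}. 2 - root_marginal (root_edge r v))"
    by (intro sum.cong refl tree_mean_degree_eq) simp
  also have "\<dots> = 2 * real (card (- {r})) - 2"
    by (simp add: sum_subtractf sum_root_marginal)
  also have "card (- {r}) = CARD('v) - 1"
    by (simp add: Compl_eq_Diff_UNIV card_Diff_singleton)
  finally show ?thesis using card3 by (simp add: of_nat_diff)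
qed

text \<open>The expected number of edges of \<open>T\<close> missing from an independent copy of the tree.\<close>

definition defect :: "'v edge set \<Rightarrow> real" where
  "defect T = (\<Sum>e \<in> T. 1 - tree_marginal e)"

text \<open>Keep only the terms of the defect at edges meeting \<open>v\<close>. Their marginals sum
  to at most the mean tree degree of \<open>v\<close>.\<close>

lemma defect_ge_degree_excess:
  assumes "v \<noteq> r"
  shows "real (degree_of T v) - 2 + root_marginal (root_edge r v) \<le> defect T"
proof -
  let ?S = "{e \<in> T. v \<in> ends e}"
  have "(\<Sum>e \<in> ?S. tree_marginal e) \<le> (\<Sum>e | v \<in> ends e. tree_marginal e)"
    by (intro sum_mono2) (auto simp: tree_marginal_nonneg)
  also have "\<dots> = 2 - root_marginal (root_edge r v)"
    using tree_mean_degree tree_mean_degree_eq[OF assms] by simp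
  finally have "real (degree_of T v) - 2 + root_marginal (root_edge r v) \<le> (\<Sum>e \<in> ?S. 1 - tree_marginal e)"
    by (simp add: sum_subtractf degree_of_def)
  also have "\<dots> \<le> defect T"
    unfolding defect_def by (intro sum_mono2) (auto simp: tree_marginal_le_1)
  finally show ?thesis .
qed

text \<open>As \<open>T\<close> has the mean size, its defect equals the marginal mass outside
  \<open>T\<close>. The edges at \<open>v\<close> outside \<open>T\<close> carry at least the mean
  degree of \<open>v\<close> minus its degree in \<open>T\<close>.\<close>

lemma defect_ge_degree_deficit:
  assumes "v \<noteq> r" "card T = CARD('v) - 2"
  shows "2 - root_marginal (root_edge r v) - real (degree_of T v) \<le> defect T"
proof -
  let ?S = "{e \<in> T. v \<in> ends e}" and ?N = "{e. v \<in> ends e}"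
  have "(\<Sum>e \<in> ?S. tree_marginal e) \<le> (\<Sum>e \<in> ?S. 1)"
    by (intro sum_mono tree_marginal_le_1)
  then have S: "(\<Sum>e \<in> ?S. tree_marginal e) \<le> real (degree_of T v)"
    by (simp add: degree_of_def)
  have "2 - root_marginal (root_edge r v) = (\<Sum>e \<in> ?N. tree_marginal e)"
    using tree_mean_degree tree_mean_degree_eq[OF assms(1)] by simp
  also have "\<dots> = (\<Sum>e \<in> ?N - T. tree_marginal e) + (\<Sum>e \<in> ?S. tree_marginal e)"
  proof -
    have "?N \<inter> T = ?S" by auto
    then show ?thesis using sum.Int_Diff[of ?N tree_marginal T] by simp
  qed
  also have "(\<Sum>e \<in> ?N - T. tree_marginal e) \<le> (\<Sum>e \<in> - T. tree_marginal e)"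
    by (intro sum_mono2) (auto simp: tree_marginal_nonneg)
  also have "(\<Sum>e \<in> - T. tree_marginal e) = (\<Sum>e \<in> UNIV. tree_marginal e) - (\<Sum>e \<in> T. tree_marginal e)"
    by (simp add: Compl_eq_Diff_UNIV sum_diff)
  also have "\<dots> = defect T"
    using assms(2) card3 by (simp add: sum_tree_marginal defect_def sum_subtractf of_nat_diff)
  finally show ?thesis using S by simp
qed

text \<open>The last term has mean half the sum of squared root marginals, so averaging over
  \<open>T\<close> reproduces the certificate exactly.\<close>

definition tree_bound :: "'v edge set \<Rightarrow> real" where
  "tree_bound T = defect T + 1
     - 1 / 2 * (\<Sum>v \<in> - {r}. (2 - real (degree_of T v)) * root_marginal (root_edge r v))"

text \<open>Degrees are at least 1 and the root marginals sum to 2, so the subtracted term is at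
  most 1.\<close>

lemma tree_bound_ge_defect:
  assumes "T \<in> trees r"
  shows "defect T \<le> tree_bound T"
proof -
  have "(\<Sum>v \<in> - {r}. (2 - real (degree_of T v)) * root_marginal (root_edge r v))
      \<le> (\<Sum>v \<in> - {r}. 1 * root_marginal (root_edge r v))"
  proof (intro sum_mono mult_right_mono root_marginal_nonneg)
    fix v assume "v \<in> - {r}"
    then show "2 - real (degree_of T v) \<le> 1"
      using degree_of_tree_pos[OF assms _ card3, of v] by simp
  qed
  then show ?thesis by (simp add: tree_bound_def sum_root_marginal)
qed

text \<open>At a branching vertex the defect alone is at least 1. On a path the bounds for the two
  leaves combine to exactly the union bound for missing a leaf edge.\<close>

lemma cond_non_tour_le:
  assumes T: "T \<in> trees r"
  shows "(\<Sum>R \<in> root_pairs r. \<rho> R * of_bool (T \<union> R \<notin> hamiltonian_cycles)) \<le> tree_bound T"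
    (is "?L \<le> _")
  using T card3
proof (cases rule: tree_cases)
  case (branching k)
  have "?L \<le> (\<Sum>R \<in> root_pairs r. \<rho> R)"
    using rho_nonneg by (intro sum_mono) (auto simp: of_bool_def)
  also have "\<dots> \<le> real (degree_of T k) - 2 + root_marginal (root_edge r k)"
    using branching(2) root_marginal_nonneg[of "root_edge r k"] by (simp add: rho_sum)
  also have "\<dots> \<le> tree_bound T"
    using defect_ge_degree_excess[OF branching(1)] tree_bound_ge_defect[OF T] by (rule order_trans)
  finally show ?thesis .
next
  case (path a b)
  let ?a = "root_edge r a" and ?b = "root_edge r b"
  have ne: "?a \<noteq> ?b"
  proof
    assume "?a = ?b"
    then have "ends ?a = ends ?b" by simp
    then show False using path(1-3) by (auto simp: doubleton_eq_iff)
  qed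
  have R: "R = {?a, ?b}" if "R \<in> root_pairs r" "?a \<in> R" "?b \<in> R" for R
  proof -
    have "card {?a, ?b} = card R" using that(1) ne by (simp add: root_pairs_def)
    then show ?thesis using that(2,3) card_subset_eq[of R "{?a, ?b}"] by auto
  qed
  \<comment> \<open>A pair containing both leaf edges gives a tour, so the non-tour indicator is at
    most the number of leaf edges missing from \<open>R\<close>.\<close>
  have "?L \<le> (\<Sum>R \<in> root_pairs r. \<rho> R * (2 - of_bool (?a \<in> R) - of_bool (?b \<in> R)))"
  proof (intro sum_mono mult_left_mono rho_nonneg)
    fix R assume R': "R \<in> root_pairs r"
    show "of_bool (T \<union> R \<notin> hamiltonian_cycles) \<le> (2 - of_bool (?a \<in> R) - of_bool (?b \<in> R) :: real)"
    proof (cases "?a \<in> R \<and> ?b \<in> R")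
      case True
      then have "T \<union> R \<in> hamiltonian_cycles" using R[OF R'] path(8) by simp
      then show ?thesis by simp
    next
      case False
      then show ?thesis by (auto simp: of_bool_def)
    qed
  qed
  also have "\<dots> = 2 - root_marginal ?a - root_marginal ?b"
    unfolding root_marginal_def right_diff_distrib sum_subtractf sum_distrib_right[symmetric] rho_sum
    by simp
  finally have L: "?L \<le> 2 - root_marginal ?a - root_marginal ?b" .
  \<comment> \<open>Inner vertices of the path have degree at least 2 and contribute at most 0; each
    leaf contributes at most its root marginal.\<close>
  have "(\<Sum>v \<in> - {r}. (2 - real (degree_of T v)) * root_marginal (root_edge r v))
      \<le> (\<Sum>v \<in> - {r}. of_bool (v \<in> {a, b}) * root_marginal (root_edge r v))"
  proof (intro sum_mono mult_right_mono root_marginal_nonneg)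
    fix v assume v: "v \<in> - {r}"
    show "2 - real (degree_of T v) \<le> of_bool (v \<in> {a, b})"
    proof (cases "v \<in> {a, b}")
      case True
      then show ?thesis using degree_of_tree_pos[OF T _ card3, of v] v by simp
    next
      case False
      then show ?thesis using path(6)[of v] v by simp
    qed
  qed
  also have "\<dots> = (\<Sum>v \<in> {a, b}. root_marginal (root_edge r v))"
    using path(1,2) by (intro sum.mono_neutral_cong_right) auto
  also have "\<dots> = root_marginal ?a + root_marginal ?b"
    using path(3) by simp
  finally have S: "(\<Sum>v \<in> - {r}. (2 - real (degree_of T v)) * root_marginal (root_edge r v))
      \<le> root_marginal ?a + root_marginal ?b" .
  \<comment> \<open>Averaging these two bounds gives \<open>defect T\<close> at least 1 minus half
    of both root marginals; adding the remainder of \<open>tree_bound\<close> reaches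
    \<open>2 - root_marginal ?a - root_marginal ?b\<close>.\<close>
  have "1 - root_marginal ?a \<le> defect T" "1 - root_marginal ?b \<le> defect T"
    using defect_ge_degree_deficit[OF path(1,7)] defect_ge_degree_deficit[OF path(2,7)] path(4,5)
    by simp_all
  then show ?thesis using L S by (simp add: tree_bound_def)
qed

lemma mean_tree_bound:
  "(\<Sum>T \<in> trees r. p T * tree_bound T) =
    bernoulli_cert r (\<chi> e. tree_marginal e + root_marginal e)"
proof -
  let ?u = "\<lambda>v. root_marginal (root_edge r v)"
  have D: "(\<Sum>T \<in> trees r. p T * defect T) = (\<Sum>e \<in> UNIV. tree_marginal e * (1 - tree_marginal e))"
  proof -
    have "defect T = (\<Sum>e \<in> UNIV. of_bool (e \<in> T) * (1 - tree_marginal e))" for T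
      unfolding defect_def by (intro sum.mono_neutral_cong_left) auto
    then show ?thesis using sum_tree_weighted[where E=UNIV and h="\<lambda>e. 1 - tree_marginal e"] by simp
  qed
  have "(\<Sum>T \<in> trees r. p T * (\<Sum>v \<in> - {r}. (2 - real (degree_of T v)) * ?u v)) =
      (\<Sum>v \<in> - {r}. \<Sum>T \<in> trees r. (p T * 2 - p T * real (degree_of T v)) * ?u v)"
    unfolding sum_distrib_left by (subst sum.swap) (simp add: algebra_simps)
  \<comment> \<open>The mean of \<open>2 - degree_of T v\<close> is again \<open>?u v\<close>, which
    produces the square.\<close>
  also have "\<dots> = (\<Sum>v \<in> - {r}. ?u v * ?u v)"
    by (intro sum.cong refl)
      (simp add: sum_distrib_right[symmetric] sum_subtractf p_sum tree_mean_degree_eq)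
  finally have U: "(\<Sum>T \<in> trees r. p T * (\<Sum>v \<in> - {r}. (2 - real (degree_of T v)) * ?u v)) =
      (\<Sum>v \<in> - {r}. ?u v * ?u v)" .
  have "(\<Sum>T \<in> trees r. p T * tree_bound T) =
      (\<Sum>T \<in> trees r. p T * defect T + p T
        - 1 / 2 * (p T * (\<Sum>v \<in> - {r}. (2 - real (degree_of T v)) * ?u v)))"
    unfolding tree_bound_def by (intro sum.cong refl) (simp only: ring_distribs mult_ac mult_1_right mult_1_left)
  also have "\<dots> = (\<Sum>e \<in> UNIV. tree_marginal e * (1 - tree_marginal e)) +
      (1 - 1 / 2 * (\<Sum>v \<in> - {r}. ?u v * ?u v))"
    unfolding sum_subtractf sum.distrib sum_distrib_left[symmetric] D U p_sum
    by (rule add_diff_eq[symmetric])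
  \<comment> \<open>The constant 1 is half the sum of the root marginals.\<close>
  also have "1 - 1 / 2 * (\<Sum>v \<in> - {r}. ?u v * ?u v) = (\<Sum>v \<in> - {r}. 1 / 2 * ?u v * (1 - ?u v))"
    using sum_root_marginal
    by (simp add: right_diff_distrib sum_subtractf sum_distrib_left[symmetric] sum_divide_distrib[symmetric])
  also have "\<dots> = (\<Sum>e | r \<in> ends e. 1 / 2 * root_marginal e * (1 - root_marginal e))"
    by (rule sum.reindex_bij_betw[OF bij_betw_root_edge])
  also have "\<dots> = (\<Sum>e \<in> UNIV. 1 / 2 * root_marginal e * (1 - root_marginal e))"
    by (intro sum.mono_neutral_left) (auto simp: root_marginal_tree_edge)
  finally have "(\<Sum>T \<in> trees r. p T * tree_bound T) = (\<Sum>e \<in> UNIV.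
      tree_marginal e * (1 - tree_marginal e) + 1 / 2 * root_marginal e * (1 - root_marginal e))"
    by (simp add: sum.distrib)
  also have "\<dots> = bernoulli_cert r (\<chi> e. tree_marginal e + root_marginal e)"
    unfolding bernoulli_cert_def
  proof (intro sum.cong refl)
    \<comment> \<open>On each edge one of the two marginals vanishes, and the weight is 1/2 or 1
      accordingly.\<close>
    fix e :: "'v edge"
    show "tree_marginal e * (1 - tree_marginal e) + 1 / 2 * root_marginal e * (1 - root_marginal e) =
      edge_weight r $ e * (\<chi> e. tree_marginal e + root_marginal e) $ e *
      (1 - (\<chi> e. tree_marginal e + root_marginal e) $ e)"
      by (cases "r \<in> ends e")
        (simp_all add: edge_weight_eq tree_marginal_root_edge root_marginal_tree_edge)
  qed
  finally show ?thesis .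
qed

lemma non_tour_le_bernoulli_cert:
  "(\<Sum>T \<in> trees r. \<Sum>R \<in> root_pairs r. p T * \<rho> R * of_bool (T \<union> R \<notin> hamiltonian_cycles))
    \<le> bernoulli_cert r (\<chi> e. tree_marginal e + root_marginal e)"
proof -
  have "(\<Sum>T \<in> trees r. \<Sum>R \<in> root_pairs r. p T * \<rho> R * of_bool (T \<union> R \<notin> hamiltonian_cycles)) =
      (\<Sum>T \<in> trees r. p T * (\<Sum>R \<in> root_pairs r. \<rho> R * of_bool (T \<union> R \<notin> hamiltonian_cycles)))"
    by (simp only: sum_distrib_left mult.assoc)
  also have "\<dots> \<le> (\<Sum>T \<in> trees r. p T * tree_bound T)"
    by (intro sum_mono mult_left_mono cond_non_tour_le p_nonneg)
  finally show ?thesis by (simp only: mean_tree_bound)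
qed

end

section \<open>The certificate for the Gibbs law\<close>

lemma inner_incidence: "x \<bullet> incidence U = (\<Sum>e \<in> U. x $ e)"
proof -
  have "x \<bullet> incidence U = (\<Sum>e \<in> UNIV. if e \<in> U then x $ e else 0)"
    unfolding inner_vec_def incidence_def by (intro sum.cong refl) simp
  then show ?thesis by (simp add: sum.If_cases)
qed

definition boltzmann :: "real \<Rightarrow> real ^ 'v::card2 edge \<Rightarrow> 'v edge set \<Rightarrow> real" where
  "boltzmann \<tau> \<eta> U = exp (- (1 / \<tau>) * (\<eta> \<bullet> incidence U))"

lemma boltzmann_pos: "0 < boltzmann \<tau> \<eta> U"
  by (simp add: boltzmann_def)

lemma partition_fun_eq: "partition_fun \<tau> r \<eta> = (\<Sum>U \<in> one_trees r. boltzmann \<tau> \<eta> U)"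
  by (simp add: partition_fun_def boltzmann_def)

lemma gibbs_eq: "gibbs \<tau> r \<eta> U = boltzmann \<tau> \<eta> U / partition_fun \<tau> r \<eta>"
  by (simp add: gibbs_def boltzmann_def)

lemma boltzmann_Un:
  assumes "T \<in> trees r" "R \<in> root_pairs r"
  shows "boltzmann \<tau> \<eta> (T \<union> R) = boltzmann \<tau> \<eta> T * boltzmann \<tau> \<eta> R"
proof -
  have "T \<inter> R = {}"
    using tree_edge_avoids_root[OF assms(1)] root_pair_edge[OF assms(2)] by blast
  then have "\<eta> \<bullet> incidence (T \<union> R) = \<eta> \<bullet> incidence T + \<eta> \<bullet> incidence R"
    unfolding inner_incidence by (intro sum.union_disjoint) auto
  then show ?thesis
    unfolding boltzmann_def by (simp only: ring_distribs exp_add)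
qed

definition tree_gibbs :: "real \<Rightarrow> 'v::card2 \<Rightarrow> real ^ 'v edge \<Rightarrow> 'v edge set \<Rightarrow> real" where
  "tree_gibbs \<tau> r \<eta> T = boltzmann \<tau> \<eta> T / (\<Sum>T \<in> trees r. boltzmann \<tau> \<eta> T)"

definition root_gibbs :: "real \<Rightarrow> 'v::card2 \<Rightarrow> real ^ 'v edge \<Rightarrow> 'v edge set \<Rightarrow> real" where
  "root_gibbs \<tau> r \<eta> R = boltzmann \<tau> \<eta> R / (\<Sum>R \<in> root_pairs r. boltzmann \<tau> \<eta> R)"

text \<open>Energies add over the disjoint parts, so both the Boltzmann weight and the partition
  function factor; this is the independence of tree and root pair.\<close>

lemma gibbs_Un:
  assumes "T \<in> trees r" "R \<in> root_pairs r"
  shows "gibbs \<tau> r \<eta> (T \<union> R) = tree_gibbs \<tau> r \<eta> T * root_gibbs \<tau> r \<eta> R"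
proof -
  have "partition_fun \<tau> r \<eta> =
      (\<Sum>T \<in> trees r. \<Sum>R \<in> root_pairs r. boltzmann \<tau> \<eta> T * boltzmann \<tau> \<eta> R)"
    unfolding partition_fun_eq sum_one_trees by (intro sum.cong refl boltzmann_Un)
  then have "partition_fun \<tau> r \<eta> =
      (\<Sum>T \<in> trees r. boltzmann \<tau> \<eta> T) * (\<Sum>R \<in> root_pairs r. boltzmann \<tau> \<eta> R)"
    by (simp only: sum_product)
  then show ?thesis
    by (simp add: gibbs_eq tree_gibbs_def root_gibbs_def boltzmann_Un[OF assms])
qed

lemma expect_gibbs:
  "expect r (gibbs \<tau> r \<eta>) f =
    (\<Sum>T \<in> trees r. \<Sum>R \<in> root_pairs r. tree_gibbs \<tau> r \<eta> T * root_gibbs \<tau> r \<eta> R * f (T \<union> R))"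
  for f :: "'v::card2 edge set \<Rightarrow> real"
  unfolding expect_def sum_one_trees by (intro sum.cong refl) (simp add: gibbs_Un)

lemma edge_mean_component:
  "edge_mean \<tau> r \<eta> $ e = expect r (gibbs \<tau> r \<eta>) (\<lambda>U. of_bool (e \<in> U))"
  by (simp add: edge_mean_def expect_def incidence_def of_bool_def)

lemma one_tree_product_law_gibbs:
  fixes r :: "'v::card2"
  assumes n: "3 \<le> CARD('v)" and eq: "equilibrated \<tau> r \<eta>"
  shows "one_tree_product_law r (tree_gibbs \<tau> r \<eta>) (root_gibbs \<tau> r \<eta>)"
proof
  have "\<exists>v. v \<noteq> r"
  proof (rule ccontr)
    assume "\<nexists>v. v \<noteq> r"
    then have "UNIV = {r}" by blast
    then have "CARD('v) = card {r}" by simp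
    then show False using n by simp
  qed
  then obtain v where "v \<noteq> r" ..
  then have "expect r (gibbs \<tau> r \<eta>) (\<lambda>U. real (degree_of U v)) = 2"
    using eq by (simp add: equilibrated_def)
  \<comment> \<open>A mean degree of 2 cannot be an empty sum, so equilibrium itself supplies
    one-trees and hence positive normalisers.\<close>
  then have "trees r \<noteq> {}" "root_pairs r \<noteq> {}"
    unfolding expect_def sum_one_trees by (intro notI; simp)+
  then have Z: "(\<Sum>T \<in> trees r. boltzmann \<tau> \<eta> T) > 0" "(\<Sum>R \<in> root_pairs r. boltzmann \<tau> \<eta> R) > 0"
    by (intro sum_pos boltzmann_pos; simp)+
  show "0 \<le> tree_gibbs \<tau> r \<eta> T" for T
    unfolding tree_gibbs_def by (intro divide_nonneg_nonneg sum_nonneg less_imp_le[OF boltzmann_pos])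
  show "0 \<le> root_gibbs \<tau> r \<eta> T" for T
    unfolding root_gibbs_def by (intro divide_nonneg_nonneg sum_nonneg less_imp_le[OF boltzmann_pos])
  show "(\<Sum>T \<in> trees r. tree_gibbs \<tau> r \<eta> T) = 1" "(\<Sum>R \<in> root_pairs r. root_gibbs \<tau> r \<eta> R) = 1"
    unfolding tree_gibbs_def root_gibbs_def sum_divide_distrib[symmetric] using Z by simp_all
  show "(\<Sum>T \<in> trees r. \<Sum>R \<in> root_pairs r.
      tree_gibbs \<tau> r \<eta> T * root_gibbs \<tau> r \<eta> R * real (degree_of (T \<union> R) v)) = 2" if "v \<noteq> r" for v
    using eq that by (simp add: equilibrated_def expect_gibbs)
qed (rule n)

lemma non_tour_mass_le_bernoulli_cert:
  fixes r :: "'v::card2"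
  assumes "3 \<le> CARD('v)" "equilibrated \<tau> r \<eta>"
  shows "non_tour_mass r (gibbs \<tau> r \<eta>) \<le> bernoulli_cert r (edge_mean \<tau> r \<eta>)"
proof -
  interpret one_tree_product_law r "tree_gibbs \<tau> r \<eta>" "root_gibbs \<tau> r \<eta>"
    using assms by (rule one_tree_product_law_gibbs)
  let ?p = "tree_gibbs \<tau> r \<eta>" and ?\<rho> = "root_gibbs \<tau> r \<eta>"
  have "non_tour_mass r (gibbs \<tau> r \<eta>) = expect r (gibbs \<tau> r \<eta>) (\<lambda>U. of_bool (U \<notin> hamiltonian_cycles))"
    unfolding non_tour_mass_def expect_def by (intro sum.mono_neutral_cong_left) auto
  also have "\<dots> \<le> bernoulli_cert r (\<chi> e. tree_marginal e + root_marginal e)"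
    unfolding expect_gibbs by (rule non_tour_le_bernoulli_cert)
  also have "(\<chi> e. tree_marginal e + root_marginal e) = edge_mean \<tau> r \<eta>"
  proof (rule vec_eq_iff[THEN iffD2], rule allI)
    fix e :: "'v edge"
    have "edge_mean \<tau> r \<eta> $ e =
        (\<Sum>T \<in> trees r. \<Sum>R \<in> root_pairs r. ?p T * ?\<rho> R * of_bool (e \<in> T \<union> R))"
      by (simp only: edge_mean_component expect_gibbs)
    also have "\<dots> = (\<Sum>T \<in> trees r. \<Sum>R \<in> root_pairs r.
        ?p T * of_bool (e \<in> T) * ?\<rho> R + ?p T * (?\<rho> R * of_bool (e \<in> R)))"
    proof (intro sum.cong refl)
      fix T R assume "T \<in> trees r" "R \<in> root_pairs r"
      then have "\<not> (e \<in> T \<and> e \<in> R)" using tree_edge_avoids_root root_pair_edge by blast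
      then show "?p T * ?\<rho> R * of_bool (e \<in> T \<union> R) =
          ?p T * of_bool (e \<in> T) * ?\<rho> R + ?p T * (?\<rho> R * of_bool (e \<in> R))"
        by auto
    qed
    also have "\<dots> = tree_marginal e + root_marginal e"
      unfolding sum.distrib sum_distrib_left[symmetric] sum_distrib_right[symmetric] rho_sum p_sum
        tree_marginal_def root_marginal_def by simp
    finally show "(\<chi> e. tree_marginal e + root_marginal e) $ e = edge_mean \<tau> r \<eta> $ e"
      by simp
  qed
  finally show ?thesis .
qed

section \<open>The equilibrated response\<close>

lemma partition_fun_pos: "one_trees r \<noteq> {} \<Longrightarrow> 0 < partition_fun \<tau> r \<eta>"
  unfolding partition_fun_eq by (intro sum_pos boltzmann_pos) simp_all

lemma sum_gibbs:
  assumes "one_trees r \<noteq> {}"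
  shows "(\<Sum>U \<in> one_trees r. gibbs \<tau> r \<eta> U) = 1"
  unfolding gibbs_eq sum_divide_distrib[symmetric]
  using partition_fun_pos[OF assms, of \<tau> \<eta>] by (simp add: partition_fun_eq)

lemma inner_edge_mean:
  "h \<bullet> edge_mean \<tau> r \<eta> = (\<Sum>U \<in> one_trees r. gibbs \<tau> r \<eta> U * (h \<bullet> incidence U))"
  by (simp add: edge_mean_def expect_def inner_sum_right)

lemma boltzmann_has_derivative:
  "((\<lambda>\<eta>. boltzmann \<tau> \<eta> U) has_derivative
     (\<lambda>h. - (1 / \<tau>) * (boltzmann \<tau> \<eta> U * (h \<bullet> incidence U)))) (at \<eta>)"
proof -
  have "((\<lambda>\<eta>. - (1 / \<tau>) * (\<eta> \<bullet> incidence U)) has_derivative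
      (\<lambda>h. - (1 / \<tau>) * (h \<bullet> incidence U))) (at \<eta>)"
    by (intro has_derivative_mult_right has_derivative_inner_left has_derivative_ident)
  from has_derivative_exp[OF this] show ?thesis
    unfolding boltzmann_def by (rule has_derivative_eq_rhs) (simp add: fun_eq_iff)
qed

lemma partition_fun_has_derivative:
  assumes "one_trees r \<noteq> {}"
  shows "(partition_fun \<tau> r has_derivative
     (\<lambda>h. - (1 / \<tau>) * (partition_fun \<tau> r \<eta> * (h \<bullet> edge_mean \<tau> r \<eta>)))) (at \<eta>)"
proof -
  have "(partition_fun \<tau> r has_derivative
      (\<lambda>h. \<Sum>U \<in> one_trees r. - (1 / \<tau>) * (boltzmann \<tau> \<eta> U * (h \<bullet> incidence U)))) (at \<eta>)"
    unfolding partition_fun_eq[abs_def] by (intro has_derivative_sum boltzmann_has_derivative)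
  moreover have "(\<Sum>U \<in> one_trees r. - (1 / \<tau>) * (boltzmann \<tau> \<eta> U * (h \<bullet> incidence U))) =
      - (1 / \<tau>) * (partition_fun \<tau> r \<eta> * (h \<bullet> edge_mean \<tau> r \<eta>))" for h
    unfolding inner_edge_mean sum_distrib_left gibbs_eq
    using partition_fun_pos[OF assms, of \<tau> \<eta>] by (intro sum.cong refl) simp
  ultimately show ?thesis by simp
qed

lemma gibbs_has_derivative:
  assumes "one_trees r \<noteq> {}"
  shows "((\<lambda>\<eta>. gibbs \<tau> r \<eta> U) has_derivative
     (\<lambda>h. - (1 / \<tau>) * (gibbs \<tau> r \<eta> U * (h \<bullet> (incidence U - edge_mean \<tau> r \<eta>))))) (at \<eta>)"
proof -
  let ?Z = "partition_fun \<tau> r \<eta>" and ?w = "boltzmann \<tau> \<eta> U"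
  have Z: "?Z \<noteq> 0" using partition_fun_pos[OF assms, of \<tau> \<eta>] by simp
  have "((\<lambda>\<eta>. gibbs \<tau> r \<eta> U) has_derivative
     (\<lambda>h. ((- (1 / \<tau>) * (?w * (h \<bullet> incidence U))) * ?Z -
        ?w * (- (1 / \<tau>) * (?Z * (h \<bullet> edge_mean \<tau> r \<eta>)))) / (?Z * ?Z))) (at \<eta>)"
    unfolding gibbs_eq
    by (rule has_derivative_divide'[OF boltzmann_has_derivative partition_fun_has_derivative[OF assms] Z])
  moreover have "((- (1 / \<tau>) * (?w * (h \<bullet> incidence U))) * ?Z -
        ?w * (- (1 / \<tau>) * (?Z * (h \<bullet> edge_mean \<tau> r \<eta>)))) / (?Z * ?Z) =
      - (1 / \<tau>) * (gibbs \<tau> r \<eta> U * (h \<bullet> (incidence U - edge_mean \<tau> r \<eta>)))" for h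
  proof -
    have "(a * (w * x) * Z - w * (a * (Z * m))) / (Z * Z) = a * (w / Z * (x - m))"
      if "Z \<noteq> 0" for a w x Z m :: real
      using that by (simp add: field_simps)
    from this[OF Z] show ?thesis by (simp only: gibbs_eq inner_diff_right)
  qed
  ultimately show ?thesis by simp
qed

text \<open>Writes the matrix form as a covariance of two linear statistics, from which its symmetry
  is immediate.\<close>

lemma inner_edge_cov:
  "y \<bullet> (edge_cov \<tau> r \<eta> *v h) = (\<Sum>U \<in> one_trees r. gibbs \<tau> r \<eta> U *
     ((y \<bullet> (incidence U - edge_mean \<tau> r \<eta>)) * (h \<bullet> (incidence U - edge_mean \<tau> r \<eta>))))"
proof -
  let ?d = "\<lambda>U. incidence U - edge_mean \<tau> r \<eta>"
  have "y \<bullet> (edge_cov \<tau> r \<eta> *v h) = (\<Sum>e \<in> UNIV. \<Sum>f \<in> UNIV. \<Sum>U \<in> one_trees r.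
      gibbs \<tau> r \<eta> U * ((y $ e * ?d U $ e) * (h $ f * ?d U $ f)))"
    by (simp add: inner_vec_def matrix_vector_mult_def edge_cov_def expect_def
        sum_distrib_left sum_distrib_right mult_ac)
  also have "\<dots> = (\<Sum>e \<in> UNIV. \<Sum>U \<in> one_trees r. \<Sum>f \<in> UNIV.
      gibbs \<tau> r \<eta> U * ((y $ e * ?d U $ e) * (h $ f * ?d U $ f)))"
    by (intro sum.cong refl sum.swap)
  also have "\<dots> = (\<Sum>U \<in> one_trees r. \<Sum>e \<in> UNIV. \<Sum>f \<in> UNIV.
      gibbs \<tau> r \<eta> U * ((y $ e * ?d U $ e) * (h $ f * ?d U $ f)))"
    by (rule sum.swap)
  also have "\<dots> = (\<Sum>U \<in> one_trees r. gibbs \<tau> r \<eta> U * ((y \<bullet> ?d U) * (h \<bullet> ?d U)))"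
    unfolding inner_vec_def sum_product by (simp only: sum_distrib_left inner_real_def)
  finally show ?thesis .
qed

lemma inner_edge_cov_commute:
  "y \<bullet> (edge_cov \<tau> r \<eta> *v h) = h \<bullet> (edge_cov \<tau> r \<eta> *v y)"
  unfolding inner_edge_cov by (simp only: mult.commute mult.left_commute)

lemma edge_mean_has_derivative:
  assumes "one_trees r \<noteq> {}"
  shows "(edge_mean \<tau> r has_derivative (\<lambda>h. - (1 / \<tau>) *\<^sub>R (edge_cov \<tau> r \<eta> *v h))) (at \<eta>)"
proof -
  let ?d = "\<lambda>U. incidence U - edge_mean \<tau> r \<eta>"
  have "(\<lambda>\<eta>. \<Sum>U \<in> one_trees r. gibbs \<tau> r \<eta> U *\<^sub>R incidence U) = edge_mean \<tau> r"
    by (simp add: fun_eq_iff edge_mean_def expect_def)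
  moreover have "((\<lambda>\<eta>. \<Sum>U \<in> one_trees r. gibbs \<tau> r \<eta> U *\<^sub>R incidence U) has_derivative
      (\<lambda>h. \<Sum>U \<in> one_trees r. (- (1 / \<tau>) * (gibbs \<tau> r \<eta> U * (h \<bullet> ?d U))) *\<^sub>R incidence U)) (at \<eta>)"
    by (intro has_derivative_sum has_derivative_scaleR_left gibbs_has_derivative assms)
  moreover have "(\<Sum>U \<in> one_trees r. (- (1 / \<tau>) * (gibbs \<tau> r \<eta> U * (h \<bullet> ?d U))) *\<^sub>R incidence U) =
      - (1 / \<tau>) *\<^sub>R (edge_cov \<tau> r \<eta> *v h)" (is "?L = ?R") for h
  proof (rule vector_eq_rdot[THEN iffD1], rule allI)
    fix y
    \<comment> \<open>Fluctuations have mean zero, so \<open>incidence U\<close> may be replaced by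
      its centred version, turning the derivative into a covariance.\<close>
    have centred: "(\<Sum>U \<in> one_trees r. gibbs \<tau> r \<eta> U * (h \<bullet> ?d U)) = 0"
      using sum_gibbs[OF assms, of \<tau> \<eta>]
      by (simp add: inner_diff_right right_diff_distrib sum_subtractf inner_edge_mean[symmetric]
          sum_distrib_right[symmetric])
    have "y \<bullet> ?L = - (1 / \<tau>) * (\<Sum>U \<in> one_trees r. gibbs \<tau> r \<eta> U * (h \<bullet> ?d U) * (y \<bullet> incidence U))"
      by (simp add: inner_sum_right sum_distrib_left mult.assoc sum_negf)
    also have "(\<Sum>U \<in> one_trees r. gibbs \<tau> r \<eta> U * (h \<bullet> ?d U) * (y \<bullet> incidence U)) =
        (\<Sum>U \<in> one_trees r. gibbs \<tau> r \<eta> U * (h \<bullet> ?d U) * (y \<bullet> ?d U)) +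
        (\<Sum>U \<in> one_trees r. gibbs \<tau> r \<eta> U * (h \<bullet> ?d U)) * (y \<bullet> edge_mean \<tau> r \<eta>)"
      by (simp add: sum_distrib_right sum.distrib[symmetric] inner_diff_right right_diff_distrib)
    also have "\<dots> = y \<bullet> (edge_cov \<tau> r \<eta> *v h)"
      unfolding centred inner_edge_cov by (simp add: mult_ac)
    finally show "?L \<bullet> y = ?R \<bullet> y"
      by (simp add: inner_commute)
  qed
  ultimately show ?thesis by simp
qed

section \<open>First-order conditions for the dual maximizer\<close>

lemma bounded_linear_lift: "bounded_linear (lift r)"
  unfolding lift_eq_transpose[abs_def] by (rule matrix_vector_mul_bounded_linear)

lemma subspace_multipliers: "subspace (multipliers r)"
  by (auto simp: subspace_def multipliers_def)

text \<open>The first-order condition in direction \<open>l\<close>: mean degrees equal to 2, tested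
  against \<open>l\<close>. This weak form is what can be differentiated in
  \<open>c\<close>.\<close>

lemma dual_maximizer_stationary:
  assumes ne: "one_trees r \<noteq> {}" and "\<tau> \<noteq> 0"
    and max: "dual_maximizer \<tau> r c m" and l: "l \<in> multipliers r"
  shows "lift r l \<bullet> edge_mean \<tau> r (c + lift r m) = 2 * (\<Sum>i \<in> - {r}. l $ i)"
proof -
  interpret lift: bounded_linear "lift r" by (rule bounded_linear_lift)
  let ?x = "\<lambda>t. c + lift r m + t *\<^sub>R lift r l"
  let ?\<mu> = "edge_mean \<tau> r (c + lift r m)" and ?Z = "partition_fun \<tau> r"
  define \<phi> where "\<phi> t = dual_objective \<tau> r c (m + t *\<^sub>R l)" for t :: real
  have \<phi>: "\<phi> t = - \<tau> * ln (?Z (?x t)) - 2 * ((\<Sum>i \<in> - {r}. m $ i) + t * (\<Sum>i \<in> - {r}. l $ i))" for t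
    by (simp add: \<phi>_def dual_objective_def lift.add lift.scaleR sum.distrib sum_distrib_left add.assoc)
  have "((\<lambda>t. ?Z (?x t)) has_derivative
      (\<lambda>t. - (1 / \<tau>) * (?Z (?x 0) * ((t *\<^sub>R lift r l) \<bullet> edge_mean \<tau> r (?x 0))))) (at 0)"
    by (rule has_derivative_compose[OF _ partition_fun_has_derivative[OF ne]])
      (auto intro!: derivative_eq_intros)
  then have "((\<lambda>t. ?Z (?x t)) has_real_derivative - (1 / \<tau>) * (?Z (?x 0) * (lift r l \<bullet> ?\<mu>))) (at 0)"
    unfolding has_field_derivative_def
    by (rule has_derivative_eq_rhs) (simp add: fun_eq_iff mult_ac)
  then have "(\<phi> has_real_derivative lift r l \<bullet> ?\<mu> - 2 * (\<Sum>i \<in> - {r}. l $ i)) (at 0)"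
    unfolding \<phi>[abs_def] using partition_fun_pos[OF ne, of \<tau> "?x 0"] \<open>\<tau> \<noteq> 0\<close>
    by (auto intro!: derivative_eq_intros)
  \<comment> \<open>The maximum is global on the subspace \<open>multipliers r\<close>, which
    contains the whole line, so radius 1 is an arbitrary choice.\<close>
  moreover have "\<forall>t. \<bar>0 - t\<bar> < 1 \<longrightarrow> \<phi> t \<le> \<phi> 0"
  proof (intro allI impI)
    fix t
    have m: "m \<in> multipliers r" and
      le: "\<And>l'. l' \<in> multipliers r \<Longrightarrow> dual_objective \<tau> r c l' \<le> dual_objective \<tau> r c m"
      using max unfolding dual_maximizer_def is_arg_max_def by (auto simp: not_less)
    have "m + t *\<^sub>R l \<in> multipliers r"
      using m l subspace_multipliers[of r] by (intro subspace_add subspace_scale)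
    then show "\<phi> t \<le> \<phi> 0" unfolding \<phi>_def using le by simp
  qed
  ultimately have "lift r l \<bullet> ?\<mu> - 2 * (\<Sum>i \<in> - {r}. l $ i) = 0"
    by (rule DERIV_local_max[OF _ zero_less_one])
  then show ?thesis by simp
qed

lemma has_derivative_eventually_const:
  assumes "(f has_derivative f') (at x)" "\<forall>\<^sub>F y in nhds x. f y = k"
  shows "f' = (\<lambda>_. 0)"
proof -
  have "((\<lambda>_. k) has_derivative f') (at x)"
    using assms(1) by (rule has_derivative_transform_eventually)
      (use assms(2) eventually_nhds_x_imp_x in \<open>auto simp: eventually_at_filter elim: eventually_mono\<close>)
  then show ?thesis by (rule has_derivative_unique[OF _ has_derivative_const])
qed

text \<open>Justifies the definite description: a subspace and its orthogonal complement span the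
  space, and two candidates differ by a vector orthogonal to itself.\<close>

lemma orth_proj_orthogonal_comp:
  assumes "subspace S"
  shows "orth_proj (S\<^sup>\<bottom>) x \<in> S\<^sup>\<bottom>" "x - orth_proj (S\<^sup>\<bottom>) x \<in> S"
proof -
  have SS: "S\<^sup>\<bottom>\<^sup>\<bottom> = S" using assms by (rule orthogonal_comp_self)
  have "\<exists>!p. p \<in> S\<^sup>\<bottom> \<and> x - p \<in> S\<^sup>\<bottom>\<^sup>\<bottom>"
  proof (rule ex_ex1I)
    have "x \<in> S + S\<^sup>\<bottom>" using subspace_sum_orthogonal_comp[OF assms] by simp
    then obtain s p where "x = s + p" "s \<in> S" "p \<in> S\<^sup>\<bottom>" by (auto elim: set_plus_elim)
    then show "\<exists>p. p \<in> S\<^sup>\<bottom> \<and> x - p \<in> S\<^sup>\<bottom>\<^sup>\<bottom>" unfolding SS by auto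
  next
    fix p q assume p: "p \<in> S\<^sup>\<bottom> \<and> x - p \<in> S\<^sup>\<bottom>\<^sup>\<bottom>" and q: "q \<in> S\<^sup>\<bottom> \<and> x - q \<in> S\<^sup>\<bottom>\<^sup>\<bottom>"
    then have "p - q \<in> S\<^sup>\<bottom>" "(x - q) - (x - p) \<in> S\<^sup>\<bottom>\<^sup>\<bottom>"
      using subspace_diff[OF subspace_orthogonal_comp] by blast+
    then have "orthogonal (p - q) (p - q)" unfolding orthogonal_comp_def by simp
    then show "p = q" by (simp add: orthogonal_self)
  qed
  from theI'[OF this] show "orth_proj (S\<^sup>\<bottom>) x \<in> S\<^sup>\<bottom>" "x - orth_proj (S\<^sup>\<bottom>) x \<in> S"
    unfolding orth_proj_def SS by auto
qed

section \<open>Descent of the certificate along its gradient\<close>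

lemma sharpening_step_decreases_cert:
  assumes tau: "\<tau> > 0" and sel: "local_selection \<tau> r c lam"
  defines "eta \<equiv> equilibrate r lam"
  defines "u \<equiv> \<lambda>c'. edge_mean \<tau> r (eta c')"
  defines "b \<equiv> bernoulli_grad r (u c)"
  defines "T \<equiv> frechet_derivative eta (at c)"
  defines "C \<equiv> edge_cov \<tau> r (eta c)"
  assumes pos: "seminorm_of C (T (orth_proj ((lift r ` multipliers r)\<^sup>\<bottom>) b)) > 0"
  shows "\<forall>\<^sub>F \<alpha> in at_right 0. bernoulli_cert r (u (c + \<alpha> *\<^sub>R b)) < bernoulli_cert r (u c)"
proof -
  interpret lift: bounded_linear "lift r" by (rule bounded_linear_lift)
  define p where "p = orth_proj ((lift r ` multipliers r)\<^sup>\<bottom>) b"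
  have p_pos: "T p \<bullet> (C *v T p) > 0"
    using pos by (simp add: seminorm_of_def p_def)
  \<comment> \<open>Without one-trees the covariance form would be zero, against its positivity at
    \<open>T p\<close>.\<close>
  have ne: "one_trees r \<noteq> {}"
  proof
    assume "one_trees r = {}"
    then have "T p \<bullet> (C *v T p) = 0" by (simp add: C_def inner_edge_cov)
    then show False using p_pos by simp
  qed
  have max: "\<forall>\<^sub>F c' in nhds c. dual_maximizer \<tau> r c' (lam c')"
    using sel by (simp add: local_selection_def)
  obtain L where L: "(lam has_derivative L) (at c)"
    using sel by (auto simp: local_selection_def differentiable_def)
  have eta: "(eta has_derivative (\<lambda>h. h + lift r (L h))) (at c)"
    unfolding eta_def equilibrate_def[abs_def]
    by (intro has_derivative_add has_derivative_ident lift.has_derivative L)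
  have T: "T h = h + lift r (L h)" for h
    unfolding T_def by (rule fun_cong[OF frechet_derivative_at[OF eta, symmetric]])
  have u: "(u has_derivative (\<lambda>h. - (1 / \<tau>) *\<^sub>R (C *v T h))) (at c)"
    unfolding u_def C_def T by (rule has_derivative_compose[OF eta edge_mean_has_derivative[OF ne]])
  \<comment> \<open>The root coordinate of the selection vanishes near \<open>c\<close>, hence so
    does that of its derivative.\<close>
  have L_mult: "L h \<in> multipliers r" for h
  proof -
    have "((\<lambda>c'. lam c' $ r) has_derivative (\<lambda>h. L h $ r)) (at c)"
      by (rule bounded_linear.has_derivative[OF bounded_linear_vec_nth L])
    moreover have "\<forall>\<^sub>F c' in nhds c. lam c' $ r = 0"
      using max by eventually_elim (simp add: dual_maximizer_def is_arg_max_def multipliers_def)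
    ultimately have "(\<lambda>h. L h $ r) = (\<lambda>_. 0)" by (rule has_derivative_eventually_const)
    then show ?thesis by (simp add: multipliers_def fun_eq_iff)
  qed
  text \<open>Equilibrium pins the mean degrees, so the response of the edge means is orthogonal to the
    range of \<open>lift r\<close>.\<close>
  have response: "lift r l \<bullet> (C *v T h) = 0" if l: "l \<in> multipliers r" for l h
  proof -
    have "((\<lambda>c'. lift r l \<bullet> u c') has_derivative
        (\<lambda>h. lift r l \<bullet> (- (1 / \<tau>) *\<^sub>R (C *v T h)))) (at c)"
      by (intro has_derivative_inner_right u)
    moreover have "\<forall>\<^sub>F c' in nhds c. lift r l \<bullet> u c' = 2 * (\<Sum>i \<in> - {r}. l $ i)"
      using max
    proof eventually_elim
      case (elim c')
      then show ?case
        using dual_maximizer_stationary[OF ne _ elim l] tau by (simp add: u_def eta_def equilibrate_def)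
    qed
    ultimately have "(\<lambda>h. lift r l \<bullet> (- (1 / \<tau>) *\<^sub>R (C *v T h))) = (\<lambda>_. 0)"
      by (rule has_derivative_eventually_const)
    from fun_cong[OF this, of h] show ?thesis using tau by simp
  qed
  \<comment> \<open>\<open>T x - x\<close> lies in the range of the lift, to which
    \<open>C *v T y\<close> is orthogonal.\<close>
  then have T_left: "T x \<bullet> (C *v T y) = x \<bullet> (C *v T y)" for x y
    by (simp add: T[of x] inner_add_left L_mult)
  have sym: "x \<bullet> (C *v T y) = y \<bullet> (C *v T x)" for x y
    using inner_edge_cov_commute[of "T x" \<tau> r "eta c" "T y"] unfolding C_def[symmetric] T_left .
  have "subspace (lift r ` multipliers r)"
    by (intro linear_subspace_image lift.linear_axioms subspace_multipliers)
  then have "b - p \<in> lift r ` multipliers r"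
    unfolding p_def by (rule orth_proj_orthogonal_comp)
  then have b_p: "b \<bullet> (C *v T y) = p \<bullet> (C *v T y)" for y
    using response[of _ y] by (auto simp: inner_diff_left algebra_simps dest!: arg_cong[of _ _ "\<lambda>z. z \<bullet> (C *v T y)"])
  \<comment> \<open>Replace the left \<open>b\<close> by \<open>p\<close>, swap by symmetry, replace
    the other \<open>b\<close> by \<open>p\<close>, then insert \<open>T\<close> on the
    left.\<close>
  have "b \<bullet> (C *v T b) = T p \<bullet> (C *v T p)"
    by (metis b_p sym T_left)
  then have neg: "- (1 / \<tau>) * (b \<bullet> (C *v T b)) < 0"
    using p_pos tau by simp
  have line: "((\<lambda>\<alpha>. c + \<alpha> *\<^sub>R b) has_derivative (\<lambda>\<alpha>. \<alpha> *\<^sub>R b)) (at 0)"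
    by (auto intro!: derivative_eq_intros)
  have cert: "((\<lambda>c'. bernoulli_cert r (u c')) has_derivative
      (\<lambda>h. (- (1 / \<tau>) *\<^sub>R (C *v T h)) \<bullet> b)) (at c)"
    using has_derivative_compose[OF u GDERIV_bernoulli_cert[unfolded gderiv_def]]
    by (simp only: b_def)
  have "((\<lambda>\<alpha>. bernoulli_cert r (u (c + \<alpha> *\<^sub>R b))) has_derivative
      (\<lambda>\<alpha>. (- (1 / \<tau>) *\<^sub>R (C *v T (\<alpha> *\<^sub>R b))) \<bullet> b)) (at 0)"
    by (rule has_derivative_compose[OF line]) (simp only: scaleR_zero_left add_0_right cert)
  moreover have "linear T"
    unfolding T_def using eta by (intro linear_frechet_derivative) (auto simp: differentiable_def)
  ultimately have "DERIV (\<lambda>\<alpha>. bernoulli_cert r (u (c + \<alpha> *\<^sub>R b))) 0 :> - (1 / \<tau>) * (b \<bullet> (C *v T b))"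
    unfolding has_field_derivative_def
    by (elim has_derivative_eq_rhs)
      (simp add: fun_eq_iff linear_cmul matrix_vector_mult_scaleR inner_commute mult_ac)
  \<comment> \<open>A strictly negative derivative at 0 gives a strict decrease for all small
    positive steps.\<close>
  from DERIV_neg_dec_right[OF this neg] obtain d where "d > 0"
    "\<And>\<alpha>. 0 < \<alpha> \<Longrightarrow> \<alpha> < d \<Longrightarrow> bernoulli_cert r (u (c + \<alpha> *\<^sub>R b)) < bernoulli_cert r (u c)"
    by auto
  then show ?thesis
    unfolding eventually_at_right_field by blast
qed

theorem proposition2p5:
  fixes r :: "'v::card2" and \<tau> :: real
  assumes "3 \<le> CARD('v)" and "\<tau> > 0"
  shows
    "(\<forall>\<eta>. equilibrated \<tau> r \<eta> \<longrightarrow>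
        non_tour_mass r (gibbs \<tau> r \<eta>) \<le> bernoulli_cert r (edge_mean \<tau> r \<eta>)) \<and>
     (\<forall>c lam. local_selection \<tau> r c lam \<longrightarrow>
        (let eta = equilibrate r lam;
             u = (\<lambda>c'. edge_mean \<tau> r (eta c'));
             b = bernoulli_grad r (u c);
             T = frechet_derivative eta (at c);
             P = orth_proj ((lift r ` multipliers r)\<^sup>\<bottom>)
         in seminorm_of (edge_cov \<tau> r (eta c)) (T (P b)) > 0 \<longrightarrow>
            (\<forall>\<^sub>F \<alpha> in at_right 0.
               bernoulli_cert r (u (c + \<alpha> *\<^sub>R b)) < bernoulli_cert r (u c))))"
proof (intro conjI allI impI)
  show "non_tour_mass r (gibbs \<tau> r \<eta>) \<le> bernoulli_cert r (edge_mean \<tau> r \<eta>)"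
    if "equilibrated \<tau> r \<eta>" for \<eta>
    using assms(1) that by (rule non_tour_mass_le_bernoulli_cert)
qed (unfold Let_def, rule impI, rule sharpening_step_decreases_cert[OF assms(2)])

end
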